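(* Let $k \ge 3$ be an integer and let $X = X_{N,p}^{k\text{-AP}}$ denote the number of $k$-term arithmetic progressions in the random set $[N]_p$. Then, for every fixed positive constant $\delta$ and all $p = p(N)$ satisfying $N^{-1}\log N \ll p^{k/2} \ll 1$, $$\lim_{N\to\infty} \frac{-\log \mathbb{P}\big(X \ge (1+\delta)\mathbb{E}[X]\big)}{N p^{k/2}\log(1/p)} = \sqrt{\delta}.$$
   Context: Write $[N]=\{1,\dots,N\}$. For $p\in(0,1)$, $[N]_p$ denotes the random subset of $[N]$ obtained by including every element independently with probability $p$. A $k$-term arithmetic progression is a sequence of $k$ integers $(a,a+b,a+2b,\dots,a+(k-1)b)$ with $b>0$ (so degenerate progressions are not counted and each progression is counted once); it is in $[N]_p$ if all its terms are. For functions of $N$, $f \ll g$ means $f(N)/g(N)\to 0$ as $N\to\infty$. Logarithms are natural. *)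

theory Defs
  imports "HOL-Probability.Probability"
begin

text \<open>Only meaningful for \<open>p \<in> [0,1]\<close>; outside, \<^const>\<open>bernoulli_pmf\<close> clamps its argument.\<close>

definition random_subset :: "nat \<Rightarrow> real \<Rightarrow> int set pmf" where
  "random_subset N p =
     map_pmf (\<lambda>c. {x \<in> {1..int N}. c x}) (Pi_pmf {1..int N} False (\<lambda>_. bernoulli_pmf p))"

definition arith_prog :: "nat \<Rightarrow> int \<Rightarrow> int \<Rightarrow> int list" where
  "arith_prog k a b = map (\<lambda>i. a + int i * b) [0..<k]"

text \<open>Progressions are counted as term sequences rather than as pairs \<open>(a, b)\<close>; for \<open>k \<ge> 2\<close> the
  two counts agree.\<close>

definition APs_in :: "nat \<Rightarrow> int set \<Rightarrow> int list set" where
  "APs_in k S = {arith_prog k a b | a b. b > 0 \<and> set (arith_prog k a b) \<subseteq> S}"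

definition AP_count :: "nat \<Rightarrow> int set \<Rightarrow> real" where
  "AP_count k S = real (card (APs_in k S))"

end

theory Submission
  imports Defs "HOL-Real_Asymp.Real_Asymp"
begin

text \<open>
  Write \<open>R\<close> for the random set, \<open>X\<close> for the number of progressions in it and \<open>G I\<close> for the
  expectation of \<open>X\<close> conditioned on \<open>I \<subseteq> R\<close>.

  Lower bound on the probability: planting an interval of length \<open>m \<approx> sqrt \<delta> N p\<^bsup>k/2\<^esup>\<close> costs \<open>p ^ m\<close>
  and raises the conditional expectation above \<open>(1 + \<delta>) E X\<close>. Since \<open>X \<le> N\<^sup>2\<close>, the reverse
  Markov inequality then loses only a factor of order \<open>p ^ k\<close>.

  Upper bound: on the event that \<open>R\<close> contains no ``seed'', that is, no set \<open>I\<close> of size at most \<open>k n\<close> with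
  \<open>G I \<ge> (1 + \<delta> - \<epsilon>) E X\<close>, the \<open>n\<close>-th moment of \<open>X\<close> is at most \<open>((1 + \<delta> - \<epsilon>) E X) ^ n\<close>, and Markov's
  inequality with \<open>n\<close> of order \<open>N p\<^bsup>k/2\<^esup> log (1/p)\<close> makes this event negligible. Every seed
  contains a ``core'', in which each element contributes substantially to \<open>G\<close> and therefore has large
  degree in the hypergraph of progressions inside the core. A core is determined up to few choices by a
  small fraction \<open>T\<close> of its elements, because most of its elements complete many progressions having
  two elements in \<open>T\<close>. Hence there are only \<open>p ^ (- o(m))\<close> cores of size \<open>m\<close>, and the union bound
  over them is dominated by the least size of a core. That size is asymptotically at least
  \<open>sqrt \<delta> N p\<^bsup>k/2\<^esup>\<close> because a set of \<open>m\<close> integers contains at most \<open>m\<^sup>2 / (2 (k - 1)) + m / 2\<close>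
  progressions.
\<close>

section \<open>Moments and conditional expectations\<close>

lemma prob_random_subset_supset:
  assumes "I \<subseteq> {1..int N}" "0 \<le> p" "p \<le> 1"
  shows "measure_pmf.prob (random_subset N p) {R. I \<subseteq> R} = p ^ card I"
proof -
  let ?V = "{1..int N}"
  let ?P = "Pi_pmf ?V False (\<lambda>_. bernoulli_pmf p)"
  have "measure_pmf.prob (random_subset N p) {R. I \<subseteq> R}
      = measure_pmf.prob ?P {c. I \<subseteq> {x \<in> ?V. c x}}"
    by (simp add: random_subset_def vimage_def)
  \<comment> \<open>Since \<open>I\<close> lies in the vertex set, containment is a product event:
    coordinates in \<open>I\<close> are forced to \<open>True\<close>, the others are free.\<close>
  also have "{c. I \<subseteq> {x \<in> ?V. c x}} = Pi ?V (\<lambda>x. if x \<in> I then {True} else UNIV)"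
    using assms(1) by (fastforce simp: Pi_iff)
  also have "measure_pmf.prob ?P \<dots> = (\<Prod>x\<in>?V. if x \<in> I then p else 1)"
    unfolding measure_Pi_pmf_Pi[OF finite_atLeastAtMost_int]
    using assms(2,3) by (intro prod.cong) (auto simp: measure_pmf_single)
  also have "\<dots> = p ^ card I"
    using assms(1) by (simp add: prod.If_cases Int_absorb1)
  finally show ?thesis .
qed

lemma set_pmf_random_subset: "set_pmf (random_subset N p) \<subseteq> Pow {1..int N}"
  by (auto simp: random_subset_def)

text \<open>Edges are indexed by \<open>F\<close> through \<open>S\<close>, so that term sequences
  can serve as edges later. The distribution of \<open>M\<close> enters through its support and
  through \<open>prob_supset\<close>, which evaluates expectations of products of edge
  indicators.\<close>

locale random_hypergraph =
  fixes V :: "'a set" and p :: real and M :: "'a set pmf"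
    and F :: "'b set" and S :: "'b \<Rightarrow> 'a set"
  assumes finite_V: "finite V" and finite_F: "finite F"
    and p_pos: "0 < p" and p_less_1: "p < 1"
    and S_subset: "a \<in> F \<Longrightarrow> S a \<subseteq> V"
    and set_pmf_M: "set_pmf M \<subseteq> Pow V"
    and prob_supset: "I \<subseteq> V \<Longrightarrow> measure_pmf.prob M {R. I \<subseteq> R} = p ^ card I"
begin

definition X :: "'a set \<Rightarrow> real" where
  "X R = real (card {a \<in> F. S a \<subseteq> R})"

text \<open>For \<open>I \<subseteq> V\<close> this is the expectation of \<^term>\<open>X\<close> conditioned on the event
  that the random set contains \<open>I\<close>.\<close>

definition G :: "'a set \<Rightarrow> real" where
  "G I = (\<Sum>a\<in>F. p ^ card (S a - I))"

lemma integrable_M [simp]: "integrable (measure_pmf M) (f :: 'a set \<Rightarrow> real)"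
  using set_pmf_M finite_V by (intro integrable_measure_pmf_finite) (auto intro: finite_subset)

lemma X_eq_sum: "X R = (\<Sum>a\<in>F. indicat_real {R. S a \<subseteq> R} R)"
  by (simp add: X_def indicator_def sum.If_cases finite_F Int_def)

lemma X_nonneg: "0 \<le> X R"
  by (simp add: X_def)

lemma X_le: "X R \<le> real (card F)"
  by (auto simp: X_def finite_F intro!: card_mono)

lemma finite_subset_V: "I \<subseteq> V \<Longrightarrow> finite I"
  using finite_V finite_subset by blast

lemma card_Un_S:
  assumes "I \<subseteq> V" "a \<in> F"
  shows "card (I \<union> S a) = card I + card (S a - I)"
  using card_Un_disjoint[of I "S a - I"] finite_subset_V[OF assms(1)]
    finite_subset_V[OF S_subset[OF assms(2)]] by auto

lemma expectation_X_supset: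
  assumes "I \<subseteq> V"
  shows "measure_pmf.expectation M (\<lambda>R. indicat_real {R. I \<subseteq> R} R * X R) = p ^ card I * G I"
proof -
  have "measure_pmf.expectation M (\<lambda>R. indicat_real {R. I \<subseteq> R} R * X R)
      = measure_pmf.expectation M (\<lambda>R. \<Sum>a\<in>F. indicat_real {R. I \<union> S a \<subseteq> R} R)"
    by (simp add: X_eq_sum sum_distrib_left indicator_def)
       (simp flip: of_bool_conj)
  also have "\<dots> = (\<Sum>a\<in>F. measure_pmf.prob M {R. I \<union> S a \<subseteq> R})"
    by (simp add: Bochner_Integration.integral_sum)
  also have "\<dots> = (\<Sum>a\<in>F. p ^ card I * p ^ card (S a - I))"
  proof (intro sum.cong refl)
    fix a assume "a \<in> F"
    then show "measure_pmf.prob M {R. I \<union> S a \<subseteq> R} = p ^ card I * p ^ card (S a - I)"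
      using prob_supset[of "I \<union> S a"] assms S_subset card_Un_S[OF assms]
      by (simp add: power_add)
  qed
  finally show ?thesis
    by (simp add: G_def sum_distrib_left)
qed

lemma expectation_X: "measure_pmf.expectation M X = G {}"
  using expectation_X_supset[of "{}"] by simp

text \<open>Reverse Markov inequality, conditioned on \<open>I\<close> being contained in the random set.\<close>

lemma upper_tail_ge:
  assumes "I \<subseteq> V" "t \<ge> 0"
  shows "p ^ card I * (G I - t) \<le> real (card F) * measure_pmf.prob M {R. X R \<ge> t}"
proof -
  \<comment> \<open>Pointwise on \<open>I \<subseteq> R\<close>, \<open>X R\<close> is below
    \<open>t\<close> off the tail event and at most \<open>card F\<close> on it.\<close>
  have "p ^ card I * G I
      \<le> measure_pmf.expectation M (\<lambda>R. t * indicat_real {R. I \<subseteq> R} R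
           + real (card F) * indicat_real {R. X R \<ge> t} R)"
    unfolding expectation_X_supset[OF assms(1), symmetric]
    using assms(2)
    by (intro integral_mono) (auto simp: indicator_def X_le intro: add_increasing)
  also have "\<dots> = t * p ^ card I + real (card F) * measure_pmf.prob M {R. X R \<ge> t}"
    by (subst Bochner_Integration.integral_add) (simp_all add: prob_supset[OF assms(1)])
  finally show ?thesis
    by (simp add: algebra_simps)
qed

text \<open>\<open>X ^ (n + 1)\<close> is expanded one edge at a time. An edge set revealed so far either contains
  a set excluded by the event or increases the moment by a factor of less than \<open>\<tau>\<close>.\<close>

lemma moment_bound:
  assumes "\<And>a. a \<in> F \<Longrightarrow> card (S a) \<le> k" "\<tau> \<ge> 0"
    and "I \<subseteq> V" "card I + k * n \<le> m"
  defines "Z \<equiv> {R. \<forall>J\<subseteq>R. J \<subseteq> V \<longrightarrow> card J \<le> m \<longrightarrow> G J < \<tau>}"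
  shows "measure_pmf.expectation M (\<lambda>R. indicat_real {R. I \<subseteq> R} R * indicat_real Z R * X R ^ n)
           \<le> p ^ card I * \<tau> ^ n"
  using assms(3,4)
proof (induction n arbitrary: I)
  case 0
  have "measure_pmf.expectation M (\<lambda>R. indicat_real {R. I \<subseteq> R} R * indicat_real Z R * X R ^ 0)
      \<le> measure_pmf.expectation M (\<lambda>R. indicat_real {R. I \<subseteq> R} R)"
    by (intro integral_mono) (auto simp: indicator_def)
  then show ?case
    using prob_supset[OF 0(1)] by simp
next
  case (Suc n)
  show ?case
  proof (cases "G I < \<tau>")
    \<comment> \<open>Here \<open>I\<close> is itself an excluded set: \<open>card I \<le> m\<close>
      by the size budget, so no \<open>R\<close> in \<open>Z\<close> contains \<open>I\<close> and
      the integrand vanishes.\<close>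
    case False
    then have "(\<lambda>R. indicat_real {R. I \<subseteq> R} R * indicat_real Z R * X R ^ Suc n) = (\<lambda>R. 0)"
      using Suc.prems by (auto simp: indicator_def Z_def fun_eq_iff)
    then show ?thesis
      using p_pos assms(2) by (simp del: power_Suc)
  next
    case True
    have "measure_pmf.expectation M (\<lambda>R. indicat_real {R. I \<subseteq> R} R * indicat_real Z R * X R ^ Suc n)
      = measure_pmf.expectation M (\<lambda>R. \<Sum>a\<in>F. indicat_real {R. I \<union> S a \<subseteq> R} R * indicat_real Z R * X R ^ n)"
      (is "?E = _")
    proof (intro Bochner_Integration.integral_cong refl)
      fix R
      have "indicat_real {R. I \<subseteq> R} R * indicat_real Z R * X R ^ Suc n
        = (\<Sum>a\<in>F. indicat_real {R. I \<subseteq> R} R * indicat_real {R. S a \<subseteq> R} R * (indicat_real Z R * X R ^ n))"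
        by (simp only: power_Suc X_eq_sum[of R, symmetric] mult_ac flip: sum_distrib_left sum_distrib_right)
      also have "\<dots> = (\<Sum>a\<in>F. indicat_real {R. I \<union> S a \<subseteq> R} R * indicat_real Z R * X R ^ n)"
        by (intro sum.cong) (auto simp: indicator_def)
      finally show "indicat_real {R. I \<subseteq> R} R * indicat_real Z R * X R ^ Suc n = \<dots>" .
    qed
    also have "\<dots> = (\<Sum>a\<in>F. measure_pmf.expectation M (\<lambda>R. indicat_real {R. I \<union> S a \<subseteq> R} R * indicat_real Z R * X R ^ n))"
      by (simp add: Bochner_Integration.integral_sum)
    also have "\<dots> \<le> (\<Sum>a\<in>F. p ^ card (I \<union> S a) * \<tau> ^ n)"
    proof (rule sum_mono)
      fix a assume a: "a \<in> F"
      \<comment> \<open>Each revealed edge uses at most \<open>k\<close> vertices of the budget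
        \<open>m\<close>, which pays for the induction step.\<close>
      have "card (I \<union> S a) \<le> card I + k"
        using card_Un_le[of I "S a"] assms(1)[OF a] by linarith
      then show "measure_pmf.expectation M (\<lambda>R. indicat_real {R. I \<union> S a \<subseteq> R} R * indicat_real Z R * X R ^ n)
          \<le> p ^ card (I \<union> S a) * \<tau> ^ n"
        using Suc.prems S_subset[OF a] by (intro Suc.IH) auto
    qed
    also have "\<dots> = p ^ card I * G I * \<tau> ^ n"
      by (simp add: card_Un_S[OF Suc.prems(1)] power_add G_def sum_distrib_left sum_distrib_right mult_ac)
    also have "\<dots> \<le> p ^ card I * \<tau> * \<tau> ^ n"
      using True p_pos assms(2) by (intro mult_right_mono mult_left_mono) auto
    finally show ?thesis
      by (simp add: mult_ac)
  qed
qed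

text \<open>Markov's inequality for the \<open>n\<close>-th power, with the indicator of the event
  kept inside the expectation; \<open>moment_bound\<close> starts from \<open>I = {}\<close>, so
  \<open>k * n\<close> vertices suffice for all \<open>n\<close> edges.\<close>

lemma upper_tail_no_seed:
  assumes "\<And>a. a \<in> F \<Longrightarrow> card (S a) \<le> k" "\<tau> \<ge> 0" "t > 0"
  shows "measure_pmf.prob M {R. X R \<ge> t \<and> (\<forall>J\<subseteq>R. J \<subseteq> V \<longrightarrow> card J \<le> k * n \<longrightarrow> G J < \<tau>)}
           \<le> (\<tau> / t) ^ n"
proof -
  define Z where "Z = {R. \<forall>J\<subseteq>R. J \<subseteq> V \<longrightarrow> card J \<le> k * n \<longrightarrow> G J < \<tau>}"
  have "t ^ n * measure_pmf.prob M {R. X R \<ge> t \<and> R \<in> Z}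
      = measure_pmf.expectation M (\<lambda>R. t ^ n * indicat_real {R. X R \<ge> t \<and> R \<in> Z} R)"
    by simp
  also have "\<dots> \<le> measure_pmf.expectation M (\<lambda>R. indicat_real {R. {} \<subseteq> R} R * indicat_real Z R * X R ^ n)"
    using assms(3) by (intro integral_mono) (auto simp: indicator_def X_nonneg intro!: power_mono)
  also have "\<dots> \<le> \<tau> ^ n"
    using moment_bound[OF assms(1,2), of "{}" n "k * n"] by (simp add: Z_def)
  finally have "t ^ n * measure_pmf.prob M {R. X R \<ge> t \<and> R \<in> Z} \<le> \<tau> ^ n" .
  then show ?thesis
    using assms(3) by (simp add: Z_def field_simps)
qed

text \<open>A minimal \<open>J \<subseteq> I\<close> subject to \<open>G J \<ge> \<tau> - \<theta> * (card I - card J)\<close>.\<close>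

lemma exists_core:
  assumes "I \<subseteq> V" "G I \<ge> \<tau>"
  shows "\<exists>J\<subseteq>I. G J \<ge> \<tau> - \<theta> * (real (card I) - real (card J)) \<and>
           (\<forall>x\<in>J. G J - G (J - {x}) \<ge> \<theta>)"
proof -
  define Q where "Q J \<longleftrightarrow> J \<subseteq> I \<and> G J \<ge> \<tau> - \<theta> * (real (card I) - real (card J))" for J
  have "Q I" using assms(2) by (simp add: Q_def)
  then obtain J where J: "Q J" and min: "\<And>J'. Q J' \<Longrightarrow> card J \<le> card J'"
    using ex_has_least_nat[of Q I card] by blast
  have "G J - G (J - {x}) \<ge> \<theta>" if x: "x \<in> J" for x
  proof (rule ccontr)
    assume "\<not> ?thesis"
    then have *: "G (J - {x}) > G J - \<theta>" by simp
    have "finite J" using J assms(1) finite_subset_V[OF assms(1)] finite_subset by (auto simp: Q_def)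
    then have c: "card J = Suc (card (J - {x}))"
      using x by (metis card.remove)
    \<comment> \<open>Deleting \<open>x\<close> lowers the threshold in \<open>Q\<close> by exactly
      \<theta> and \<open>G\<close> by less, so the smaller set still satisfies
      \<open>Q\<close>.\<close>
    have "Q (J - {x})"
      using J * c by (auto simp: Q_def algebra_simps)
    then show False using min c by fastforce
  qed
  then show ?thesis using J by (auto simp: Q_def)
qed

end

section \<open>Counting sets of large minimum degree\<close>

text \<open>Exponential weighting: with \<open>x = t / n \<le> 1\<close> every counted
  \<open>T\<close> has \<open>x ^ card T \<ge> x powr t\<close>, while the weights of all subsets
  sum to \<open>(1 + x) ^ card A \<le> exp t\<close>.\<close>

lemma card_small_subsets_le:
  fixes n t :: real
  assumes "finite A" "real (card A) \<le> n" "0 < t" "t \<le> n"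
  shows "real (card {T. T \<subseteq> A \<and> real (card T) \<le> t}) \<le> (exp 1 * n / t) powr t"
proof -
  define x where "x = t / n"
  have x: "0 < x" "x \<le> 1" using assms by (auto simp: x_def)
  have "real (card {T. T \<subseteq> A \<and> real (card T) \<le> t}) * x powr t
      = (\<Sum>T | T \<subseteq> A \<and> real (card T) \<le> t. x powr t)"
    by simp
  also have "\<dots> \<le> (\<Sum>T | T \<subseteq> A \<and> real (card T) \<le> t. x ^ card T)"
  proof (rule sum_mono)
    fix T assume "T \<in> {T. T \<subseteq> A \<and> real (card T) \<le> t}"
    then have "x powr t \<le> x powr real (card T)" using x by (intro powr_mono') auto
    then show "x powr t \<le> x ^ card T" using x by (simp only: powr_realpow)
  qed
  also have "\<dots> \<le> (\<Sum>T\<in>Pow A. x ^ card T)"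
    using assms(1) x by (intro sum_mono2) auto
  also have "\<dots> = (1 + x) ^ card A"
    using prod_add[OF assms(1), of "\<lambda>_. x" "\<lambda>_. 1"] by (simp add: add.commute)
  also have "\<dots> \<le> exp x ^ card A"
    using x by (intro power_mono) auto
  also have "\<dots> = exp (x * real (card A))"
    using exp_of_nat_mult[of "card A" x] by (simp add: mult.commute)
  also have "\<dots> \<le> exp t"
    using assms mult_left_mono[OF assms(2), of x] x by (simp add: x_def)
  finally have "real (card {T. T \<subseteq> A \<and> real (card T) \<le> t}) \<le> exp t / x powr t"
    using x by (simp add: pos_le_divide_eq)
  also have "\<dots> = (exp 1 * n / t) powr t"
  proof -
    have "exp 1 * n / t = exp 1 / x" by (simp add: x_def)
    moreover have "(exp 1 / x) powr t = exp 1 powr t / x powr t" by (rule powr_divide)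
    moreover have "exp (1 :: real) powr t = exp t" by (simp add: powr_def)
    ultimately show ?thesis by simp
  qed
  finally show ?thesis .
qed

text \<open>\<open>J\<close> is maximal subject to the potential \<open>\<Sum>x\<in>P. min s (deg x)\<close> being large compared
  to \<open>card J\<close>: too many unsaturated vertices would allow another vertex to be added.\<close>

lemma exists_saturating_set:
  fixes D e :: real and s :: nat
  assumes "finite P" "finite Y" "e \<ge> 0" "D > s"
    and deg: "\<And>x. x \<in> P \<Longrightarrow> real (card {y \<in> Y. E x y}) \<ge> D"
  shows "\<exists>J\<subseteq>Y. real (card {x \<in> P. card {y \<in> J. E x y} < s}) \<le> e \<and>
           real (card J) * (e * (D - s)) \<le> real s * real (card P) * real (card Y)"
proof -
  define \<Phi> where "\<Phi> J = (\<Sum>x\<in>P. min s (card {y \<in> J. E x y}))" for J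
  define Q where "Q J \<longleftrightarrow> J \<subseteq> Y \<and> real (card J) * (e * (D - s)) \<le> real (\<Phi> J) * real (card Y)" for J
  have "Q {}" by (simp add: Q_def)
  moreover have "\<And>J. Q J \<Longrightarrow> card J \<le> card Y"
    using assms(2) by (auto simp: Q_def card_mono)
  ultimately obtain J where J: "Q J" and max: "\<And>J'. Q J' \<Longrightarrow> card J' \<le> card J"
    using ex_has_greatest_nat[of Q "{}" card "Suc (card Y)"] by (metis le_imp_less_Suc)
  have JY: "J \<subseteq> Y" using J by (simp add: Q_def)
  then have fJ: "finite J" using assms(2) finite_subset by blast
  define U where "U = {x \<in> P. card {y \<in> J. E x y} < s}"
  have fU: "finite U" using assms(1) by (simp add: U_def)
  have "real (card U) \<le> e"
  proof (rule ccontr)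
    assume "\<not> ?thesis"
    then have U: "real (card U) > e" by simp
    \<comment> \<open>An unsaturated vertex has fewer than \<open>s\<close> neighbours in
      \<open>J\<close>, so at least \<open>D - s\<close> of its neighbours are still
      available.\<close>
    have deg': "real (card {y \<in> Y - J. E x y}) \<ge> D - s" if "x \<in> U" for x
    proof -
      have "{y \<in> Y. E x y} = {y \<in> J. E x y} \<union> {y \<in> Y - J. E x y}" using JY by auto
      then have "card {y \<in> Y. E x y} \<le> card {y \<in> J. E x y} + card {y \<in> Y - J. E x y}"
        by (metis card_Un_le)
      moreover have "card {y \<in> J. E x y} < s" "x \<in> P" using that by (auto simp: U_def)
      ultimately show ?thesis using deg[of x] by linarith
    qed
    \<comment> \<open>Averaging: the pairs between \<open>U\<close> and \<open>Y - J\<close> number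
      at least \<open>card U * (D - s)\<close>, so some \<open>y\<close> has at least the average
      share of them.\<close>
    have "\<exists>y\<in>Y - J. e * (D - s) \<le> real (card {x \<in> U. E x y}) * real (card Y)"
    proof (rule ccontr)
      assume *: "\<not> ?thesis"
      have "U \<noteq> {}" using U assms(3) by auto
      then obtain x where "x \<in> U" by auto
      then have "real (card {y \<in> Y - J. E x y}) \<noteq> 0" using deg'[of x] assms(4) by linarith
      then have "Y - J \<noteq> {}" by (metis (no_types, lifting) card.empty empty_Collect_eq empty_iff of_nat_0)
      then have pos: "real (card (Y - J)) > 0" using assms(2) by (auto simp: card_gt_0_iff)
      have "e * (D - s) * real (card Y) \<le> real (card U) * (D - s) * real (card Y)"
        using U assms(4) by (intro mult_right_mono) auto
      also have "\<dots> \<le> (\<Sum>x\<in>U. real (card {y \<in> Y - J. E x y})) * real (card Y)"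
        using sum_mono[of U "\<lambda>_. D - s", OF deg'] by (intro mult_right_mono) auto
      also have "(\<Sum>x\<in>U. real (card {y \<in> Y - J. E x y})) = (\<Sum>y\<in>Y - J. real (card {x \<in> U. E x y}))"
        using sum_multicount_gen[of U "Y - J" E "\<lambda>y. card {x \<in> U. E x y}"] fU assms(2)
        by (simp flip: of_nat_sum)
      also have "\<dots> * real (card Y) = (\<Sum>y\<in>Y - J. real (card {x \<in> U. E x y}) * real (card Y))"
        by (simp add: sum_distrib_right)
      also have "\<dots> < (\<Sum>y\<in>Y - J. e * (D - s))"
        using * \<open>Y - J \<noteq> {}\<close> assms(2)
        by (intro sum_strict_mono) (simp_all add: not_le del: Diff_iff)
      also have "\<dots> = real (card (Y - J)) * (e * (D - s))" by simp
      also have "\<dots> \<le> real (card Y) * (e * (D - s))"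
        using assms by (intro mult_right_mono) (auto intro!: card_mono)
      finally show False by simp
    qed
    then obtain y where y: "y \<in> Y - J" "e * (D - s) \<le> real (card {x \<in> U. E x y}) * real (card Y)"
      by blast
    \<comment> \<open>Adding \<open>y\<close> raises the capped degree of each of its unsaturated
      neighbours by one, since they are below the cap; hence \<open>Q\<close> survives for the
      larger set.\<close>
    have "\<Phi> J + card {x \<in> U. E x y} = (\<Sum>x\<in>P. min s (card {y \<in> J. E x y}) + (if x \<in> U \<and> E x y then 1 else 0))"
      using assms(1) by (simp add: \<Phi>_def sum.distrib U_def sum.If_cases Int_def)
    also have "\<dots> \<le> \<Phi> (insert y J)"
      unfolding \<Phi>_def
    proof (rule sum_mono)
      fix x assume "x \<in> P"
      have "{y' \<in> insert y J. E x y'} = (if E x y then insert y {y \<in> J. E x y} else {y \<in> J. E x y})"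
        by auto
      then have "card {y' \<in> insert y J. E x y'} = card {y \<in> J. E x y} + (if E x y then 1 else 0)"
        using y fJ by simp
      then show "min s (card {y \<in> J. E x y}) + (if x \<in> U \<and> E x y then 1 else 0)
          \<le> min s (card {y' \<in> insert y J. E x y'})"
        by (auto simp: U_def)
    qed
    finally have "real (\<Phi> J) + real (card {x \<in> U. E x y}) \<le> real (\<Phi> (insert y J))"
      by linarith
    then have "(real (\<Phi> J) + real (card {x \<in> U. E x y})) * real (card Y) \<le> real (\<Phi> (insert y J)) * real (card Y)"
      by (intro mult_right_mono) auto
    then have "Q (insert y J)"
      using J y fJ by (auto simp: Q_def algebra_simps)
    then show False using max[of "insert y J"] y fJ by auto
  qed
  moreover have "\<Phi> J \<le> s * card P"
    using sum_mono[of P "\<lambda>x. min s (card {y \<in> J. E x y})" "\<lambda>_. s"]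
    by (simp add: \<Phi>_def mult.commute)
  then have "real (\<Phi> J) \<le> real s * real (card P)"
    by (metis of_nat_le_iff of_nat_mult)
  then have "real (card J) * (e * (D - s)) \<le> real s * real (card P) * real (card Y)"
    using J mult_right_mono[of "real (\<Phi> J)" "real s * real (card P)" "real (card Y)"]
    by (simp add: Q_def)
  ultimately show ?thesis using JY by (auto simp: U_def)
qed

text \<open>The saturating set for \<open>s\<close> equal to \<eta>^2 D rounded up and
  \<open>e = \<eta> * card Y\<close>. As \<eta>^2 D \<ge> 1, rounding at most doubles it, and \<eta>
  \<le> 1/2 then gives \<open>D - s \<ge> D / 2\<close>; the factor 4 is the product of these two
  losses.\<close>

lemma exists_saturating_set':
  fixes D \<eta> :: real
  assumes "finite Y" "P \<subseteq> Y" "0 < \<eta>" "\<eta> \<le> 1 / 2" "\<eta>\<^sup>2 * D \<ge> 1"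
    and deg: "\<And>x. x \<in> P \<Longrightarrow> real (card {y \<in> Y. E x y}) \<ge> D"
  shows "\<exists>J\<subseteq>Y. real (card J) \<le> 4 * \<eta> * real (card Y) \<and>
           real (card {x \<in> P. real (card {y \<in> J. E x y}) < \<eta>\<^sup>2 * D}) \<le> \<eta> * real (card Y)"
proof -
  define s where "s = nat \<lceil>\<eta>\<^sup>2 * D\<rceil>"
  have s: "\<eta>\<^sup>2 * D \<le> real s" "real s \<le> 2 * (\<eta>\<^sup>2 * D)"
    using assms(5) by (auto simp: s_def) linarith
  have D: "D > 0" using assms(3,5) by (smt (verit) mult_nonneg_nonpos zero_le_power2)
  have "\<eta>\<^sup>2 \<le> 1 / 4" using power_mono[of \<eta> "1/2" 2] assms(3,4) by (simp add: power2_eq_square)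
  then have sD: "real s \<le> D / 2" using s(2) mult_right_mono[of "\<eta>\<^sup>2" "1/4" D] D by linarith
  have "\<exists>J\<subseteq>Y. real (card {x \<in> P. card {y \<in> J. E x y} < s}) \<le> \<eta> * real (card Y) \<and>
      real (card J) * (\<eta> * real (card Y) * (D - s)) \<le> real s * real (card P) * real (card Y)"
    using assms(3) sD D
    by (intro exists_saturating_set[OF finite_subset[OF assms(2,1)] assms(1)] deg) auto
  then obtain J where J: "J \<subseteq> Y" "real (card {x \<in> P. card {y \<in> J. E x y} < s}) \<le> \<eta> * real (card Y)"
    "real (card J) * (\<eta> * real (card Y) * (D - s)) \<le> real s * real (card P) * real (card Y)"
    by blast
  have "real (card J) \<le> 4 * \<eta> * real (card Y)"
  proof (cases "card Y = 0")
    case True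
    then show ?thesis using J(1) assms(1) by auto
  next
    case False
    have "real (card J) * (\<eta> * real (card Y) * (D / 2)) \<le> real (card J) * (\<eta> * real (card Y) * (D - s))"
      using sD assms(3) by (intro mult_left_mono) auto
    also have "\<dots> \<le> (2 * (\<eta>\<^sup>2 * D)) * real (card Y) * real (card Y)"
      using J(3) s(2) D card_mono[OF assms(1,2)]
      by (intro order_trans[OF J(3)] mult_right_mono mult_mono) auto
    finally have "real (card J) * (\<eta> * real (card Y) * (D / 2))
        \<le> (4 * \<eta> * real (card Y)) * (\<eta> * real (card Y) * (D / 2))"
      by (simp add: power2_eq_square mult_ac)
    then show ?thesis
      using False D assms(3) by (subst (asm) mult_le_cancel_right) auto
  qed
  moreover have "{x \<in> P. real (card {y \<in> J. E x y}) < \<eta>\<^sup>2 * D} \<subseteq> {x \<in> P. card {y \<in> J. E x y} < s}"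
    using s(1) by auto
  then have "card {x \<in> P. real (card {y \<in> J. E x y}) < \<eta>\<^sup>2 * D} \<le> card {x \<in> P. card {y \<in> J. E x y} < s}"
    using assms(1,2) by (intro card_mono) (auto intro: finite_subset)
  then have "real (card {x \<in> P. real (card {y \<in> J. E x y}) < \<eta>\<^sup>2 * D}) \<le> \<eta> * real (card Y)"
    using J(2) by linarith
  ultimately show ?thesis using J(1) by blast
qed

text \<open>Models triples in which any two members admit few choices of the third. Rotation carries
  the bound for one pair of positions to the other pairs.\<close>

locale triple_system =
  fixes V :: "'a set" and H :: "'a \<Rightarrow> 'a \<Rightarrow> 'a \<Rightarrow> bool" and \<kappa> :: real
  assumes finite_V: "finite V"
    and H_rotate: "H x y z \<Longrightarrow> H y z x"
    and codegree: "real (card {x \<in> V. H x y z}) \<le> \<kappa>"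
    and \<kappa>_ge_1: "\<kappa> \<ge> 1"
begin

text \<open>Elements that can be recovered from a fingerprint \<open>T\<close> alone. Counting
  partners \<open>y\<close> rather than pairs \<open>(y, z)\<close> matches the degrees delivered by
  the saturation lemma.\<close>

definition candidates :: "real \<Rightarrow> 'a set \<Rightarrow> 'a set" where
  "candidates s T = {x \<in> V. real (card {y \<in> T. \<exists>z\<in>T. H x y z}) \<ge> s}"

text \<open>Double counting of triples with two members in \<open>T\<close>: each of the
  \<open>(card T)^2\<close> ordered pairs is completed by at most \<kappa> elements.\<close>

lemma card_candidates:
  assumes "T \<subseteq> V"
  shows "real (card (candidates s T)) * s \<le> \<kappa> * (real (card T))\<^sup>2"
proof -
  have fT: "finite T" using assms finite_V finite_subset by blast
  have fC: "finite (candidates s T)" using finite_V by (simp add: candidates_def)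
  have "real (card (candidates s T)) * s \<le> (\<Sum>x\<in>candidates s T. real (card {y \<in> T. \<exists>z\<in>T. H x y z}))"
    using sum_mono[of "candidates s T" "\<lambda>_. s" "\<lambda>x. real (card {y \<in> T. \<exists>z\<in>T. H x y z})"]
    by (auto simp: candidates_def)
  also have "\<dots> \<le> (\<Sum>x\<in>V. real (card {y \<in> T. \<exists>z\<in>T. H x y z}))"
    using finite_V by (intro sum_mono2) (auto simp: candidates_def)
  also have "\<dots> \<le> (\<Sum>x\<in>V. real (card {q \<in> T \<times> T. H x (fst q) (snd q)}))"
  proof (rule sum_mono)
    fix x
    have "{y \<in> T. \<exists>z\<in>T. H x y z} = fst ` {q \<in> T \<times> T. H x (fst q) (snd q)}" by force
    then show "real (card {y \<in> T. \<exists>z\<in>T. H x y z}) \<le> real (card {q \<in> T \<times> T. H x (fst q) (snd q)})"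
      using fT by (simp add: card_image_le)
  qed
  also have "\<dots> = (\<Sum>q\<in>T \<times> T. real (card {x \<in> V. H x (fst q) (snd q)}))"
    using sum_multicount_gen[of V "T \<times> T" "\<lambda>x q. H x (fst q) (snd q)" "\<lambda>q. card {x \<in> V. H x (fst q) (snd q)}"]
      fT finite_V by (simp flip: of_nat_sum)
  also have "\<dots> \<le> (\<Sum>q\<in>T \<times> T. \<kappa>)"
    by (intro sum_mono codegree)
  also have "\<dots> = \<kappa> * (real (card T))\<^sup>2"
    by (simp add: card_cartesian_product power2_eq_square)
  finally show ?thesis .
qed

text \<open>Saturation is applied twice. First \<open>J1\<close> is chosen so that most
  \<open>x\<close> keep many \<open>z\<close> in \<open>J1\<close>; next \<open>J2\<close> does the
  same for \<open>y\<close>, with \<open>z\<close> already confined to \<open>J1\<close>.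
  Exceptional elements join \<open>T\<close>, and 4 + 4 + 1 + 1 gives the constant 10.\<close>

lemma exists_fingerprint:
  fixes D \<eta> :: real
  assumes "I \<subseteq> V" "0 < \<eta>" "\<eta> \<le> 1 / 2" "\<eta> ^ 4 * D \<ge> \<kappa>"
    and deg: "\<And>x. x \<in> I \<Longrightarrow> real (card {z \<in> I. \<exists>y\<in>I. H x y z}) \<ge> D"
  shows "\<exists>T\<subseteq>I. real (card T) \<le> 10 * \<eta> * real (card I) \<and> I \<subseteq> T \<union> candidates (\<eta> ^ 4 * D / \<kappa>) T"
proof -
  have fI: "finite I" using assms(1) finite_V finite_subset by blast
  define D2 where "D2 = \<eta>\<^sup>2 * D / \<kappa>"
  have D2: "\<eta>\<^sup>2 * D2 = \<eta> ^ 4 * D / \<kappa>" by (simp add: D2_def power2_eq_square power4_eq_xxxx)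
  have D2_ge: "\<eta>\<^sup>2 * D2 \<ge> 1" unfolding D2 using assms(4) \<kappa>_ge_1 by simp
  have "\<eta>\<^sup>2 \<le> 1" using assms(2,3) by (simp add: power_le_one)
  then have "\<eta>\<^sup>2 * (\<eta>\<^sup>2 * D) \<le> 1 * (\<eta>\<^sup>2 * D)" if "D \<ge> 0"
    using that by (intro mult_right_mono) auto
  moreover have "D \<ge> 0" using assms(2,4) \<kappa>_ge_1 by (smt (verit) mult_nonneg_nonpos zero_le_power)
  ultimately have D_ge: "\<eta>\<^sup>2 * D \<ge> 1"
    using assms(4) \<kappa>_ge_1 by (simp add: power2_eq_square power4_eq_xxxx mult.assoc)
  obtain J1 where J1: "J1 \<subseteq> I" "real (card J1) \<le> 4 * \<eta> * real (card I)"
    "real (card {x \<in> I. real (card {z \<in> J1. \<exists>y\<in>I. H x y z}) < \<eta>\<^sup>2 * D}) \<le> \<eta> * real (card I)"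
    using exists_saturating_set'[of I I \<eta> D "\<lambda>x z. \<exists>y\<in>I. H x y z", OF fI order_refl assms(2,3) D_ge deg]
    by auto
  define U1 where "U1 = {x \<in> I. real (card {z \<in> J1. \<exists>y\<in>I. H x y z}) < \<eta>\<^sup>2 * D}"
  have deg2: "real (card {y \<in> I. \<exists>z\<in>J1. H x y z}) \<ge> D2" if x: "x \<in> I - U1" for x
  proof -
    \<comment> \<open>Degree in \<open>z\<close> becomes degree in \<open>y\<close>: with
      \<open>x\<close> fixed, each \<open>y\<close> accounts for at most \<kappa> values of
      \<open>z\<close>.\<close>
    have "{z \<in> J1. \<exists>y\<in>I. H x y z} \<subseteq> (\<Union>y\<in>{y \<in> I. \<exists>z\<in>J1. H x y z}. {z \<in> V. H z x y})"
    proof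
      fix z assume "z \<in> {z \<in> J1. \<exists>y\<in>I. H x y z}"
      then obtain y where "z \<in> J1" "y \<in> I" "H x y z" by blast
      moreover from this have "H z x y" using H_rotate by blast
      ultimately show "z \<in> (\<Union>y\<in>{y \<in> I. \<exists>z\<in>J1. H x y z}. {z \<in> V. H z x y})"
        using J1(1) assms(1) by auto
    qed
    then have "card {z \<in> J1. \<exists>y\<in>I. H x y z} \<le> card (\<Union>y\<in>{y \<in> I. \<exists>z\<in>J1. H x y z}. {z \<in> V. H z x y})"
      using fI finite_V by (intro card_mono) auto
    also have "\<dots> \<le> (\<Sum>y\<in>{y \<in> I. \<exists>z\<in>J1. H x y z}. card {z \<in> V. H z x y})"
      using fI by (intro card_UN_le) auto
    finally have "real (card {z \<in> J1. \<exists>y\<in>I. H x y z})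
        \<le> (\<Sum>y\<in>{y \<in> I. \<exists>z\<in>J1. H x y z}. real (card {z \<in> V. H z x y}))"
      by (simp flip: of_nat_sum)
    also have "\<dots> \<le> (\<Sum>y\<in>{y \<in> I. \<exists>z\<in>J1. H x y z}. \<kappa>)"
      by (intro sum_mono codegree)
    finally have "\<eta>\<^sup>2 * D \<le> real (card {y \<in> I. \<exists>z\<in>J1. H x y z}) * \<kappa>"
      using x by (auto simp: U1_def)
    then show ?thesis using \<kappa>_ge_1 by (simp add: D2_def field_simps)
  qed
  obtain J2 where J2: "J2 \<subseteq> I" "real (card J2) \<le> 4 * \<eta> * real (card I)"
    "real (card {x \<in> I - U1. real (card {y \<in> J2. \<exists>z\<in>J1. H x y z}) < \<eta>\<^sup>2 * D2}) \<le> \<eta> * real (card I)"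
    using exists_saturating_set'[of I "I - U1" \<eta> D2 "\<lambda>x y. \<exists>z\<in>J1. H x y z", OF fI Diff_subset assms(2,3) D2_ge deg2]
    by auto
  define U2 where "U2 = {x \<in> I - U1. real (card {y \<in> J2. \<exists>z\<in>J1. H x y z}) < \<eta>\<^sup>2 * D2}"
  define T where "T = J1 \<union> J2 \<union> (U1 \<union> U2)"
  have "T \<subseteq> I" using J1(1) J2(1) by (auto simp: T_def U1_def U2_def)
  moreover have "card T \<le> card J1 + card J2 + (card U1 + card U2)"
    unfolding T_def by (intro order_trans[OF card_Un_le] add_mono card_Un_le)
  then have "real (card T) \<le> 10 * \<eta> * real (card I)"
    using J1(2) J2(2) J1(3)[folded U1_def] J2(3)[folded U2_def] by linarith
  moreover have "x \<in> T \<union> candidates (\<eta> ^ 4 * D / \<kappa>) T" if x: "x \<in> I" for x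
  proof (cases "x \<in> T")
    case False
    then have "\<eta>\<^sup>2 * D2 \<le> real (card {y \<in> J2. \<exists>z\<in>J1. H x y z})"
      using x by (auto simp: T_def U2_def)
    also have "\<dots> \<le> real (card {y \<in> T. \<exists>z\<in>T. H x y z})"
    proof -
      have "finite T" using \<open>T \<subseteq> I\<close> fI by (rule finite_subset)
      moreover have "{y \<in> J2. \<exists>z\<in>J1. H x y z} \<subseteq> {y \<in> T. \<exists>z\<in>T. H x y z}"
        unfolding T_def by blast
      ultimately show ?thesis by (simp add: card_mono)
    qed
    finally show ?thesis using x assms(1) by (auto simp: candidates_def D2)
  qed auto
  ultimately show ?thesis by blast
qed

text \<open>\<open>I\<close> is determined by its fingerprint \<open>T\<close> and by
  \<open>I \<inter> candidates s T\<close>. There are few sets \<open>T\<close> because they have at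
  most \<open>10 * \<eta> * m\<close> elements, and the second part is chosen from only
  \<open>Q * m\<close> candidates.\<close>

lemma card_dense_sets:
  fixes D \<eta> Q :: real and m :: nat
  assumes "m > 0" "0 < \<eta>" "10 * \<eta> \<le> 1" "\<eta> ^ 4 * D \<ge> \<kappa>" "Q \<ge> 1" "\<kappa>\<^sup>2 * m \<le> Q * (\<eta> ^ 4 * D)"
  defines "\<I> \<equiv> {I. I \<subseteq> V \<and> card I = m \<and> (\<forall>x\<in>I. real (card {z \<in> I. \<exists>y\<in>I. H x y z}) \<ge> D)}"
  shows "real (card \<I>) \<le> (exp 1 * real (card V) / (10 * \<eta> * m)) powr (10 * \<eta> * m) * (exp 1 * Q) powr m"
proof (cases "\<I> = {}")
  case False
  then obtain I where "I \<in> \<I>" by blast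
  then have "m \<le> card V" using finite_V by (auto simp: \<I>_def card_mono)
  define t where "t = 10 * \<eta> * m"
  define s where "s = \<eta> ^ 4 * D / \<kappa>"
  have t: "0 < t" "t \<le> m" using assms(1-3) by (auto simp: t_def)
  then have tV: "t \<le> card V" using \<open>m \<le> card V\<close> by linarith
  define \<T> where "\<T> = {T. T \<subseteq> V \<and> real (card T) \<le> t}"
  define \<W> where "\<W> T = {W. W \<subseteq> candidates s T \<and> real (card W) \<le> real m}" for T
  have fT: "finite \<T>" using finite_V by (simp add: \<T>_def)
  have fc: "finite (candidates s T)" for T using finite_V by (simp add: candidates_def)
  then have fW: "finite (\<W> T)" for T by (simp add: \<W>_def)
  have W: "real (card (\<W> T)) \<le> (exp 1 * Q) powr m" if T: "T \<in> \<T>" for T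
  proof -
    have "s \<ge> 1" using assms(4) \<kappa>_ge_1 by (simp add: s_def)
    have "real (card (candidates s T)) * s \<le> \<kappa> * (real (card T))\<^sup>2"
      using T by (intro card_candidates) (simp add: \<T>_def)
    also have "\<dots> \<le> \<kappa> * (real m)\<^sup>2"
      using T t(2) \<kappa>_ge_1 by (intro mult_left_mono power_mono) (auto simp: \<T>_def)
    also have "\<dots> \<le> (Q * m) * s"
    proof -
      have "\<kappa> * m \<le> Q * s" using assms(6) \<kappa>_ge_1 by (simp add: s_def field_simps power2_eq_square)
      then show ?thesis using mult_right_mono[of "\<kappa> * m" "Q * s" m] by (simp add: power2_eq_square mult_ac)
    qed
    finally have "real (card (candidates s T)) \<le> Q * m"
      using \<open>s \<ge> 1\<close> by (subst (asm) mult_le_cancel_right) auto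
    then have "real (card (\<W> T)) \<le> (exp 1 * (Q * m) / m) powr m"
      unfolding \<W>_def using assms(1,5) fc by (intro card_small_subsets_le) auto
    then show ?thesis using assms(1) by simp
  qed
  have "\<I> \<subseteq> (\<lambda>q. fst q \<union> snd q) ` (SIGMA T:\<T>. \<W> T)"
  proof
    fix I assume I: "I \<in> \<I>"
    then have "\<exists>T\<subseteq>I. real (card T) \<le> 10 * \<eta> * real (card I) \<and> I \<subseteq> T \<union> candidates s T"
      unfolding s_def using assms(2-4) by (intro exists_fingerprint) (auto simp: \<I>_def)
    then obtain T where T: "T \<subseteq> I" "real (card T) \<le> t" "I \<subseteq> T \<union> candidates s T"
      using I by (auto simp: \<I>_def t_def)
    have "finite I" using I finite_V by (auto simp: \<I>_def intro: finite_subset)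
    then have "card (I \<inter> candidates s T) \<le> m" using I by (auto simp: \<I>_def intro!: card_mono)
    then have "(T, I \<inter> candidates s T) \<in> (SIGMA T:\<T>. \<W> T)"
      using T I by (auto simp: \<T>_def \<W>_def \<I>_def)
    moreover have "I = fst (T, I \<inter> candidates s T) \<union> snd (T, I \<inter> candidates s T)" using T by auto
    ultimately show "I \<in> (\<lambda>q. fst q \<union> snd q) ` (SIGMA T:\<T>. \<W> T)" by (rule rev_image_eqI)
  qed
  then have "card \<I> \<le> card (SIGMA T:\<T>. \<W> T)"
    using fT fW by (intro surj_card_le) auto
  also have "\<dots> = (\<Sum>T\<in>\<T>. card (\<W> T))" using fT fW by simp
  finally have "real (card \<I>) \<le> (\<Sum>T\<in>\<T>. real (card (\<W> T)))" by (simp flip: of_nat_sum)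
  also have "\<dots> \<le> real (card \<T>) * (exp 1 * Q) powr m"
    using sum_mono[of \<T> "\<lambda>T. real (card (\<W> T))", OF W] by simp
  also have "\<dots> \<le> (exp 1 * real (card V) / t) powr t * (exp 1 * Q) powr m"
    unfolding \<T>_def using finite_V t tV by (intro mult_right_mono card_small_subsets_le) auto
  finally show ?thesis by (simp add: t_def)
qed auto

end

section \<open>Arithmetic progressions\<close>

lemma length_arith_prog [simp]: "length (arith_prog k a b) = k"
  by (simp add: arith_prog_def)

lemma nth_arith_prog [simp]: "i < k \<Longrightarrow> arith_prog k a b ! i = a + int i * b"
  by (simp add: arith_prog_def)

lemma set_arith_prog: "set (arith_prog k a b) = (\<lambda>i. a + int i * b) ` {..<k}"
  by (auto simp: arith_prog_def)

lemma arith_prog_eqI: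
  assumes "i < k" "j < k" "i \<noteq> j"
    and "arith_prog k a b ! i = arith_prog k a' b' ! i" "arith_prog k a b ! j = arith_prog k a' b' ! j"
  shows "arith_prog k a b = arith_prog k a' b'"
proof -
  have *: "a + int i * b = a' + int i * b'" "a + int j * b = a' + int j * b'"
    using assms by auto
  have "(int i - int j) * (b - b') = (a + int i * b) - (a + int j * b) - ((a' + int i * b') - (a' + int j * b'))"
    by (simp only: algebra_simps)
  also have "\<dots> = 0" by (simp only: *)
  finally have "b = b'" using assms(3) by simp
  moreover from this have "a = a'" using *(1) by simp
  ultimately show ?thesis by simp
qed

lemma card_set_arith_prog: "b > 0 \<Longrightarrow> card (set (arith_prog k a b)) = k"
  unfolding set_arith_prog by (subst card_image) (auto simp: inj_on_def)

lemma APs_in_iff: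
  "l \<in> APs_in k I \<longleftrightarrow> (\<exists>a b. l = arith_prog k a b \<and> b > 0) \<and> set l \<subseteq> I"
  by (auto simp: APs_in_def)

lemma APs_in_eqI:
  assumes "l \<in> APs_in k I" "l' \<in> APs_in k I'" "i < k" "j < k" "i \<noteq> j" "l ! i = l' ! i" "l ! j = l' ! j"
  shows "l = l'"
proof -
  obtain a b where l: "l = arith_prog k a b" using assms(1) unfolding APs_in_iff by blast
  obtain a' b' where l': "l' = arith_prog k a' b'" using assms(2) unfolding APs_in_iff by blast
  show ?thesis
    unfolding l l' using assms(3-7) unfolding l l' by (rule arith_prog_eqI)
qed

lemma APs_in_length: "l \<in> APs_in k I \<Longrightarrow> length l = k"
  by (auto simp: APs_in_iff)

lemma APs_in_card_set: "l \<in> APs_in k I \<Longrightarrow> card (set l) = k"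
  by (auto simp: APs_in_iff card_set_arith_prog)

lemma finite_APs_in: "finite I \<Longrightarrow> finite (APs_in k I)"
  by (rule finite_subset[OF _ finite_lists_length_eq[of I k]]) (auto simp: APs_in_iff)

lemma APs_in_Collect: "I \<subseteq> J \<Longrightarrow> {l \<in> APs_in k J. set l \<subseteq> I} = APs_in k I"
  by (intro set_eqI) (simp add: APs_in_iff, blast)

lemma APs_in_two_positions:
  assumes "i < k" "j < k" "i \<noteq> j"
  shows "finite {l \<in> APs_in k I. l ! i = x \<and> l ! j = y} \<and> card {l \<in> APs_in k I. l ! i = x \<and> l ! j = y} \<le> 1"
proof -
  have "\<exists>l0. {l \<in> APs_in k I. l ! i = x \<and> l ! j = y} \<subseteq> {l0}"
    using APs_in_eqI[OF _ _ assms, of _ I _ I] by (auto simp: subset_singleton_iff) blast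
  then obtain l0 where "{l \<in> APs_in k I. l ! i = x \<and> l ! j = y} \<subseteq> {l0}" by blast
  then show ?thesis
    using card_mono[of "{l0}"] finite_subset[of _ "{l0}"] by fastforce
qed

text \<open>Once the positions of \<open>x\<close> and \<open>y\<close> are fixed, at most one
  progression remains.\<close>

lemma card_APs_through_two:
  assumes "x \<noteq> y"
  shows "card {l \<in> APs_in k I. x \<in> set l \<and> y \<in> set l} \<le> k ^ 2"
proof -
  let ?A = "\<lambda>q. {l \<in> APs_in k I. l ! fst q = x \<and> l ! snd q = y}"
  let ?Q = "{q \<in> {..<k} \<times> {..<k}. fst q \<noteq> snd q}"
  have A: "finite (?A q) \<and> card (?A q) \<le> 1" if "q \<in> ?Q" for q
    using that by (intro APs_in_two_positions) auto
  have "{l \<in> APs_in k I. x \<in> set l \<and> y \<in> set l} \<subseteq> (\<Union>q\<in>?Q. ?A q)"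
  proof
    fix l assume l: "l \<in> {l \<in> APs_in k I. x \<in> set l \<and> y \<in> set l}"
    then obtain i j where ij: "i < k" "l ! i = x" "j < k" "l ! j = y"
      by (auto simp: in_set_conv_nth APs_in_length)
    then show "l \<in> (\<Union>q\<in>?Q. ?A q)"
      using l assms by (intro UN_I[of "(i, j)"]) auto
  qed
  then have "card {l \<in> APs_in k I. x \<in> set l \<and> y \<in> set l} \<le> card (\<Union>q\<in>?Q. ?A q)"
    using A by (intro card_mono) auto
  also have "\<dots> \<le> (\<Sum>q\<in>?Q. card (?A q))" by (rule card_UN_le) auto
  also have "\<dots> \<le> (\<Sum>q\<in>?Q. 1)" using A by (intro sum_mono) auto
  also have "\<dots> = card ?Q" by simp
  also have "\<dots> \<le> card ({..<k} \<times> {..<k})" by (intro card_mono) auto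
  finally show ?thesis by (simp add: power2_eq_square)
qed

lemma card_APs_through:
  assumes "k \<ge> 2" "finite I"
  shows "card {l \<in> APs_in k I. x \<in> set l} \<le> k * card I"
proof -
  \<comment> \<open>\<open>?o i\<close> is a position other than \<open>i\<close>, and a valid one
    as \<open>k \<ge> 2\<close>: the term there, together with \<open>x\<close>, fixes the
    progression.\<close>
  let ?o = "\<lambda>i::nat. if i = 0 then 1 else 0"
  let ?A = "\<lambda>q. {l \<in> APs_in k I. l ! fst q = x \<and> l ! ?o (fst q) = snd q}"
  have A: "finite (?A q) \<and> card (?A q) \<le> 1" if "q \<in> {..<k} \<times> I" for q
    using that assms(1) by (intro APs_in_two_positions) auto
  have "{l \<in> APs_in k I. x \<in> set l} \<subseteq> (\<Union>q\<in>{..<k} \<times> I. ?A q)"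
  proof
    fix l assume l: "l \<in> {l \<in> APs_in k I. x \<in> set l}"
    then obtain i where i: "i < k" "l ! i = x" by (auto simp: in_set_conv_nth APs_in_length)
    have "l ! ?o i \<in> set l" using l assms(1) by (intro nth_mem) (auto simp: APs_in_length)
    then have "l ! ?o i \<in> I" using l by (auto simp: APs_in_iff)
    then show "l \<in> (\<Union>q\<in>{..<k} \<times> I. ?A q)"
      using l i by (intro UN_I[of "(i, l ! ?o i)"]) auto
  qed
  then have "card {l \<in> APs_in k I. x \<in> set l} \<le> card (\<Union>q\<in>{..<k} \<times> I. ?A q)"
    using A assms(2) by (intro card_mono) auto
  also have "\<dots> \<le> (\<Sum>q\<in>{..<k} \<times> I. card (?A q))" using assms(2) by (intro card_UN_le) auto
  also have "\<dots> \<le> (\<Sum>q\<in>{..<k} \<times> I. 1)" using A by (intro sum_mono) auto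
  finally show ?thesis by (simp add: card_cartesian_product)
qed

text \<open>If \<open>t\<^sub>i\<close> is the rank in \<open>I\<close> of the \<open>i\<close>-th term of a progression and \<open>w = (card I - 1) / (k - 1)\<close>,
  then \<open>t\<^sub>i - i w\<close> changes sign, so two consecutive terms have ranks in the same block
  \<open>[i w, (i + 1) w]\<close>, and they determine the progression.\<close>

lemma card_APs_in_le:
  assumes "k \<ge> 2" "finite I"
  shows "real (card (APs_in k I)) \<le> (real (card I))\<^sup>2 / (2 * (real k - 1)) + real (card I) / 2"
proof (cases "I = {}")
  case True
  have "APs_in k I = {}"
  proof (rule ccontr)
    assume "APs_in k I \<noteq> {}"
    then obtain l where l: "l \<in> APs_in k I" by blast
    then have "set l = {}" using True by (auto simp: APs_in_iff)
    then show False using APs_in_card_set[OF l] assms(1) by simp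
  qed
  then show ?thesis using True by simp
next
  case False
  define m where "m = card I"
  have m: "m \<ge> 1" using False assms(2) by (simp add: m_def Suc_le_eq card_gt_0_iff)
  define w where "w = (real m - 1) / (real k - 1)"
  have w: "w \<ge> 0" "w * (real k - 1) = real m - 1" using m assms(1) by (auto simp: w_def)
  define r where "r x = card {y \<in> I. y < x}" for x
  have r_mono: "r x < r y" if "x \<in> I" "x < y" for x y
    unfolding r_def using that assms(2) by (intro psubset_card_mono) auto
  then have r_inj: "inj_on r I" unfolding inj_on_def by (metis less_irrefl linorder_neqE)
  have r_le: "real (r x) \<le> real m - 1" if "x \<in> I" for x
  proof -
    have "r x < m" unfolding r_def m_def using that assms(2) by (intro psubset_card_mono) auto
    then show ?thesis by linarith
  qed
  \<comment> \<open>Adjacent blocks share an endpoint, which need not be an integer. Ranks are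
    distinct integers, so a block of length \<open>w\<close> holds at most \<open>w + 1\<close>
    elements.\<close>
  define B where "B i = {x \<in> I. real i * w \<le> real (r x) \<and> real (r x) \<le> (real i + 1) * w}" for i :: nat
  have fB: "finite (B i)" for i using assms(2) by (simp add: B_def)
  have card_B: "real (card (B i)) \<le> w + 1" for i
  proof -
    have "r ` B i \<subseteq> {nat \<lceil>real i * w\<rceil>..nat \<lfloor>(real i + 1) * w\<rfloor>}"
      by (auto simp: B_def le_nat_floor)
    then have "card (B i) \<le> card {nat \<lceil>real i * w\<rceil>..nat \<lfloor>(real i + 1) * w\<rfloor>}"
      using r_inj by (intro card_inj_on_le[of r]) (auto simp: B_def inj_on_def)
    then have "real (card (B i)) \<le> real (Suc (nat \<lfloor>(real i + 1) * w\<rfloor>) - nat \<lceil>real i * w\<rceil>)"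
      by simp
    also have "\<dots> \<le> w + 1"
    proof (cases "nat \<lceil>real i * w\<rceil> \<le> Suc (nat \<lfloor>(real i + 1) * w\<rfloor>)")
      case True
      have "real (nat \<lfloor>(real i + 1) * w\<rfloor>) \<le> (real i + 1) * w" using w(1) by simp
      moreover have "real i * w \<le> real (nat \<lceil>real i * w\<rceil>)" by (rule real_nat_ceiling_ge)
      ultimately show ?thesis using True by (simp add: of_nat_diff algebra_simps)
    next
      case False
      then have "Suc (nat \<lfloor>(real i + 1) * w\<rfloor>) - nat \<lceil>real i * w\<rceil> = 0" by linarith
      then show ?thesis using w(1) by simp
    qed
    finally show ?thesis .
  qed
  have choose_2: "real (n choose 2) = real n * (real n - 1) / 2" for n
    by (induction n) (auto simp: numeral_2_eq_2 field_simps)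
  define A where "A i = {l \<in> APs_in k I. l ! i \<in> B i \<and> l ! Suc i \<in> B i}" for i
  have card_A: "real (card (A i)) \<le> (w + 1) * w / 2" if i: "i < k - 1" for i
  proof -
    have lt: "l ! i < l ! Suc i" if "l \<in> A i" for l
      using that i by (auto simp: A_def APs_in_iff algebra_simps)
    \<comment> \<open>The positive difference orders the two terms, so the unordered pair still
      determines both.\<close>
    have "inj_on (\<lambda>l. {l ! i, l ! Suc i}) (A i)"
    proof (rule inj_onI)
      fix l l' assume *: "l \<in> A i" "l' \<in> A i" "{l ! i, l ! Suc i} = {l' ! i, l' ! Suc i}"
      then have "l ! i = l' ! i" "l ! Suc i = l' ! Suc i"
        using lt[of l] lt[of l'] by (auto simp: doubleton_eq_iff)
      then show "l = l'" using *(1,2) i by (intro APs_in_eqI[of l k I l' I i "Suc i"]) (auto simp: A_def)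
    qed
    moreover have "(\<lambda>l. {l ! i, l ! Suc i}) ` A i \<subseteq> {P. P \<subseteq> B i \<and> card P = 2}"
      using lt by (force simp: A_def)
    ultimately have "card (A i) \<le> card {P. P \<subseteq> B i \<and> card P = 2}"
      using fB by (intro card_inj_on_le) auto
    also have "\<dots> = card (B i) choose 2" by (rule n_subsets[OF fB])
    finally have "real (card (A i)) \<le> real (card (B i) choose 2)" by simp
    also have "\<dots> = real (card (B i)) * (real (card (B i)) - 1) / 2"
      by (rule choose_2)
    also have "\<dots> \<le> (w + 1) * w / 2"
    proof (cases "card (B i) = 0")
      case False
      then show ?thesis using card_B[of i] w(1) by (intro divide_right_mono mult_mono) auto
    qed (use w(1) in auto)
    finally show ?thesis .
  qed
  have "APs_in k I \<subseteq> (\<Union>i<k - 1. A i)"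
  proof
    fix l assume l: "l \<in> APs_in k I"
    have lI: "l ! i \<in> I" if "i < k" for i
    proof -
      have "l ! i \<in> set l" using l that by (intro nth_mem) (simp add: APs_in_length)
      then show ?thesis using l by (auto simp: APs_in_iff)
    qed
    define P where "P j \<longleftrightarrow> real (r (l ! Suc j)) \<le> real (Suc j) * w" for j
    \<comment> \<open>\<open>i\<close> is the first index whose successor term has rank at most
      \<open>(i + 1) * w\<close>. It exists by \<open>Pk\<close>, as the last term has rank at most
      \<open>card I - 1 = (k - 1) * w\<close>; minimality gives the lower end of the block.\<close>
    define i where "i = (LEAST j. P j)"
    have Pk: "P (k - 2)"
      using r_le[OF lI[of "Suc (k - 2)"]] assms(1) w(2) by (simp add: P_def of_nat_diff mult.commute)
    then have "P i" "i \<le> k - 2" unfolding i_def by (auto intro: LeastI Least_le)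
    then have ik: "i < k - 1" using assms(1) by linarith
    have "real i * w \<le> real (r (l ! i))"
    proof (cases i)
      case (Suc j)
      then have "\<not> P j" using not_less_Least[of j P] by (simp add: i_def)
      then show ?thesis using Suc by (simp add: P_def)
    qed simp
    moreover have "r (l ! i) < r (l ! Suc i)"
      using l ik by (intro r_mono lI) (auto simp: APs_in_iff algebra_simps)
    ultimately have "l \<in> A i"
      using l lI ik \<open>P i\<close> by (auto simp: A_def B_def P_def add.commute)
    then show "l \<in> (\<Union>i<k - 1. A i)" using ik by blast
  qed
  then have "card (APs_in k I) \<le> card (\<Union>i<k - 1. A i)"
    using assms(2) finite_APs_in by (intro card_mono) (auto simp: A_def)
  also have "\<dots> \<le> (\<Sum>i<k - 1. card (A i))" by (rule card_UN_le) simp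
  finally have "real (card (APs_in k I)) \<le> (\<Sum>i<k - 1. real (card (A i)))" by (simp flip: of_nat_sum)
  also have "\<dots> \<le> (\<Sum>i<k - 1. (w + 1) * w / 2)" using card_A by (intro sum_mono) auto
  also have "\<dots> = (w * (real k - 1)) * (w + 1) / 2" using assms(1) by (simp add: of_nat_diff)
  also have "\<dots> = (real m - 1) * ((real m - 1) / (real k - 1) + 1) / 2" unfolding w(2) by (simp add: w_def)
  also have "\<dots> \<le> real m * (real m / (real k - 1) + 1) / 2"
    using m assms(1) by (intro divide_right_mono mult_mono add_mono) auto
  also have "\<dots> = (real m)\<^sup>2 / (2 * (real k - 1)) + real m / 2"
    by (simp add: power2_eq_square distrib_left add_divide_distrib)
  finally show ?thesis by (simp only: m_def)
qed

text \<open>Count by difference \<open>b\<close>: there are \<open>m - (k - 1) * b\<close> first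
  terms for every \<open>b\<close> up to \<open>m div (k - 1)\<close>, and the arithmetic series is
  summed exactly.\<close>

lemma card_APs_in_interval_ge:
  assumes "k \<ge> 2"
  shows "real (card (APs_in k {1..int m})) \<ge> (real m)\<^sup>2 / (2 * (real k - 1)) - real m / 2"
proof -
  define q where "q = k - 1"
  have q: "q \<ge> 1" "real q = real k - 1" using assms by (auto simp: q_def)
  define B where "B = m div q"
  define P where "P = (SIGMA b:{1..B}. {1..m - q * b})"
  let ?f = "\<lambda>(b, a). arith_prog k (int a) (int b)"
  have "?f ` P \<subseteq> APs_in k {1..int m}"
  proof (clarsimp simp: P_def APs_in_iff, intro conjI)
    fix a b assume ab: "Suc 0 \<le> b" "b \<le> B" "Suc 0 \<le> a" "a \<le> m - q * b"
    show "\<exists>a' b'. arith_prog k (int a) (int b) = arith_prog k a' b' \<and> 0 < b'"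
      using ab by (intro exI[of _ "int a"] exI[of _ "int b"]) auto
    have "q * b \<le> m" using ab(2) q unfolding B_def
      by (metis le_trans mult_le_mono2 times_div_less_eq_dividend)
    have "int a + int i * int b \<le> int m" if "i < k" for i
    proof -
      have "i * b \<le> q * b" using that by (intro mult_right_mono) (auto simp: q_def)
      then have "a + i * b \<le> m" using ab(4) \<open>q * b \<le> m\<close> by linarith
      then show ?thesis by (metis of_nat_add of_nat_mult of_nat_mono)
    qed
    moreover have "1 \<le> int a + int i * int b" for i
      using ab(3) by (metis add_increasing2 of_nat_0_le_iff of_nat_mult of_nat_mono One_nat_def of_nat_1)
    ultimately show "set (arith_prog k (int a) (int b)) \<subseteq> {1..int m}"
      by (auto simp: set_arith_prog)
  qed
  moreover have "inj_on ?f P"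
  proof (rule inj_onI, clarsimp)
    fix a b a' b' assume "arith_prog k (int a) (int b) = arith_prog k (int a') (int b')"
    then have "\<And>i. i < k \<Longrightarrow> int a + int i * int b = int a' + int i * int b'"
      by (metis nth_arith_prog)
    from this[of 0] this[of 1] show "b = b' \<and> a = a'" using assms by auto
  qed
  ultimately have "card P \<le> card (APs_in k {1..int m})"
    by (intro card_inj_on_le) (auto simp: finite_APs_in)
  moreover have "real (card P) \<ge> (real m)\<^sup>2 / (2 * real q) - real m / 2"
  proof -
    have gauss: "2 * (\<Sum>b=1..n. real m - real q * real b) = 2 * (real m * n) - real q * (real n * (real n + 1))" for n
      by (induction n) (auto simp: algebra_simps)
    have "real (card P) \<ge> (\<Sum>b=1..B. real m - real q * real b)"
      unfolding P_def by (subst card_SigmaI) (auto intro!: sum_mono simp flip: of_nat_mult)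
    moreover have "real m * B - real q * (real B * (real B + 1)) / 2 \<ge> (real m)\<^sup>2 / (2 * real q) - real m / 2"
    proof -
      \<comment> \<open>With \<open>m = q B + s\<close>, twice \<open>q\<close> times the series
        exceeds \<open>m^2 - q m\<close> by \<open>s (q - s)\<close>, which is nonnegative for a
        remainder.\<close>
      define s where "s = m mod q"
      have m: "real m = real q * real B + real s"
        unfolding B_def s_def by (metis mult_div_mod_eq of_nat_add of_nat_mult)
      have s: "real s \<le> real q" using q(1) mod_less_divisor[of q m] unfolding s_def by linarith
      have "real q * (2 * (real m * B - real q * (real B * (real B + 1)) / 2)) - ((real m)\<^sup>2 - real q * real m)
        = real s * (real q - real s)"
        unfolding m by (simp add: power2_eq_square algebra_simps)
      also have "\<dots> \<ge> 0" using s by simp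
      finally have "(real m)\<^sup>2 - real q * real m \<le> real q * (2 * (real m * B - real q * (real B * (real B + 1)) / 2))"
        by simp
      then show ?thesis using q(1) by (simp add: field_simps)
    qed
    ultimately show ?thesis using gauss[of B] by linarith
  qed
  ultimately show ?thesis unfolding q(2) by linarith
qed

section \<open>Triples of terms of a common progression\<close>

definition AP_triple :: "nat \<Rightarrow> int \<Rightarrow> int \<Rightarrow> int \<Rightarrow> bool" where
  "AP_triple k x y z \<longleftrightarrow> distinct [x, y, z] \<and> (\<exists>l\<in>APs_in k UNIV. {x, y, z} \<subseteq> set l)"

text \<open>The positions of \<open>y\<close> and \<open>z\<close> fix the progression and the
  position of \<open>x\<close> then fixes \<open>x\<close>, whence \<open>k ^ 3\<close>.\<close>

lemma codegree_AP_triple: "card {x \<in> V. AP_triple k x y z} \<le> k ^ 3"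
proof -
  let ?Q = "{..<k} \<times> {..<k} \<times> {..<k}"
  let ?A = "\<lambda>(i, j, n). {x. i \<noteq> j \<and> (\<exists>l\<in>APs_in k UNIV. l ! i = y \<and> l ! j = z \<and> x = l ! n)}"
  have A: "finite (?A q) \<and> card (?A q) \<le> 1" if q: "q \<in> ?Q" for q
  proof -
    obtain i j n where q_eq: "q = (i, j, n)" by (cases q) auto
    have "\<exists>x0. ?A q \<subseteq> {x0}"
    proof (cases "\<exists>l\<in>APs_in k UNIV. i \<noteq> j \<and> l ! i = y \<and> l ! j = z")
      case True
      then obtain l where l: "l \<in> APs_in k UNIV" "i \<noteq> j" "l ! i = y" "l ! j = z" by blast
      have "l' = l" if "l' \<in> APs_in k UNIV" "l' ! i = y" "l' ! j = z" for l'
        using that l q by (intro APs_in_eqI[of l' k UNIV l UNIV i j]) (auto simp: q_eq)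
      then have "?A q \<subseteq> {l ! n}" by (auto simp: q_eq)
      then show ?thesis by blast
    qed (auto simp: q_eq)
    then obtain x0 where "?A q \<subseteq> {x0}" by blast
    then show ?thesis using card_mono[of "{x0}" "?A q"] finite_subset[of _ "{x0}"] by auto
  qed
  have "{x \<in> V. AP_triple k x y z} \<subseteq> (\<Union>q\<in>?Q. ?A q)"
  proof
    fix x assume "x \<in> {x \<in> V. AP_triple k x y z}"
    then obtain l where l: "l \<in> APs_in k UNIV" "x \<in> set l" "y \<in> set l" "z \<in> set l" "y \<noteq> z"
      by (auto simp: AP_triple_def)
    then obtain i j n where "i < k" "l ! i = y" "j < k" "l ! j = z" "n < k" "l ! n = x"
      by (auto simp: in_set_conv_nth APs_in_length)
    then show "x \<in> (\<Union>q\<in>?Q. ?A q)"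
      using l by (intro UN_I[of "(i, j, n)"]) auto
  qed
  then have "card {x \<in> V. AP_triple k x y z} \<le> card (\<Union>q\<in>?Q. ?A q)"
    using A by (intro card_mono) auto
  also have "\<dots> \<le> (\<Sum>q\<in>?Q. card (?A q))" by (rule card_UN_le) auto
  also have "\<dots> \<le> (\<Sum>q\<in>?Q. 1)" using A by (intro sum_mono) auto
  finally show ?thesis by (simp add: power3_eq_cube)
qed

text \<open>Translates degree in the hypergraph of progressions into the degree that
  \<open>exists_fingerprint\<close> requires. Since \<open>k \<ge> 3\<close>, every progression
  through \<open>x\<close> provides a \<open>y\<close> and a \<open>z\<close>, and a given
  \<open>z\<close> shares at most \<open>k^2\<close> progressions with \<open>x\<close>.\<close>

lemma card_APs_through_le_neighbours:
  assumes "k \<ge> 3" "finite I"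
  shows "card {l \<in> APs_in k I. x \<in> set l} \<le> k ^ 2 * card {z \<in> I. \<exists>y\<in>I. AP_triple k x y z}"
proof -
  let ?N = "{z \<in> I. \<exists>y\<in>I. AP_triple k x y z}"
  have "{l \<in> APs_in k I. x \<in> set l} \<subseteq> (\<Union>z\<in>?N. {l \<in> APs_in k I. x \<in> set l \<and> z \<in> set l})"
  proof
    fix l assume l: "l \<in> {l \<in> APs_in k I. x \<in> set l}"
    then have "card (set l - {x}) \<ge> 2" using assms(1) APs_in_card_set[of l k I] by simp
    then obtain T where "T \<subseteq> set l - {x}" "card T = 2" by (meson obtain_subset_with_card_n)
    then obtain y z where yz: "y \<in> set l - {x}" "z \<in> set l - {x}" "y \<noteq> z"
      by (auto simp: card_2_iff)
    moreover have "l \<in> APs_in k UNIV" using l unfolding APs_in_iff by blast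
    ultimately have "AP_triple k x y z" "z \<in> I" "y \<in> I"
      using l by (auto simp: AP_triple_def) (auto simp: APs_in_iff)
    then show "l \<in> (\<Union>z\<in>?N. {l \<in> APs_in k I. x \<in> set l \<and> z \<in> set l})" using l yz by auto
  qed
  then have "card {l \<in> APs_in k I. x \<in> set l} \<le> card (\<Union>z\<in>?N. {l \<in> APs_in k I. x \<in> set l \<and> z \<in> set l})"
    using assms(2) finite_APs_in[OF assms(2)] by (intro card_mono) auto
  also have "\<dots> \<le> (\<Sum>z\<in>?N. card {l \<in> APs_in k I. x \<in> set l \<and> z \<in> set l})"
    using assms(2) by (intro card_UN_le) auto
  also have "\<dots> \<le> (\<Sum>z\<in>?N. k ^ 2)"
    by (intro sum_mono card_APs_through_two) (auto simp: AP_triple_def)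
  finally show ?thesis by (simp add: mult.commute)
qed

section \<open>Tail bounds for progressions in a random set\<close>

lemma sum_mult_of_bool:
  "finite A \<Longrightarrow> (\<Sum>x\<in>A. c * of_bool (P x)) = c * real (card {x \<in> A. P x})"
  by (simp add: sum_distrib_left[symmetric] Int_def)

locale random_APs =
  fixes k N :: nat and p :: real
  assumes k_ge_3: "k \<ge> 3" and p_pos: "0 < p" and p_less_1: "p < 1"
begin

abbreviation V :: "int set" where "V \<equiv> {1..int N}"

abbreviation F :: "int list set" where "F \<equiv> APs_in k V"

sublocale random_hypergraph V p "random_subset N p" F set
  by unfold_locales
    (use p_pos p_less_1 set_pmf_random_subset prob_random_subset_supset in
      \<open>auto simp: finite_APs_in APs_in_iff simp del: set_pmf_iff\<close>)

sublocale triple_system V "AP_triple k" "real (k ^ 3)"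
proof unfold_locales
  show "AP_triple k y z x" if "AP_triple k x y z" for x y z
    using that by (auto simp: AP_triple_def)
  show "real (card {x \<in> V. AP_triple k x y z}) \<le> real (k ^ 3)" for y z
    using codegree_AP_triple by (metis of_nat_mono)
  show "real (k ^ 3) \<ge> 1" using k_ge_3 by simp
qed simp

lemma X_eq_AP_count: "R \<subseteq> V \<Longrightarrow> X R = AP_count k R"
  by (simp add: X_def AP_count_def APs_in_Collect)

lemma X_eq_AP_count': "R \<in> set_pmf (random_subset N p) \<Longrightarrow> X R = AP_count k R"
  using X_eq_AP_count set_pmf_random_subset[of N p] by blast

text \<open>\<open>X\<close> ignores elements outside \<open>V\<close>, so the two events are
  compared on the support of the random subset.\<close>

lemma prob_AP_count_ge:
  "measure_pmf.prob (random_subset N p) {R. AP_count k R \<ge> t}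
     = measure_pmf.prob (random_subset N p) {R. X R \<ge> t}"
proof -
  have "{R. AP_count k R \<ge> t} \<inter> set_pmf (random_subset N p) = {R. X R \<ge> t} \<inter> set_pmf (random_subset N p)"
    using X_eq_AP_count' by auto
  then show ?thesis by (metis measure_Int_set_pmf)
qed

lemma expectation_AP_count: "measure_pmf.expectation (random_subset N p) (AP_count k) = G {}"
proof -
  have "measure_pmf.expectation (random_subset N p) (AP_count k)
      = measure_pmf.expectation (random_subset N p) X"
    by (intro integral_cong_AE) (auto simp: AE_measure_pmf_iff X_eq_AP_count')
  then show ?thesis by (simp add: expectation_X)
qed

section \<open>Estimates for the conditional expectation of the progression count\<close>

lemma G_empty: "G {} = real (card F) * p ^ k"
  by (simp add: G_def APs_in_card_set)

text \<open>A progression inside \<open>I\<close> has weight 1 instead of \<open>p ^ k\<close>; for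
  all others conditioning can only increase the weight.\<close>

lemma G_ge:
  assumes "I \<subseteq> V"
  shows "G I \<ge> G {} + (1 - p ^ k) * real (card (APs_in k I))"
proof -
  have "G {} + (1 - p ^ k) * real (card (APs_in k I))
      = (\<Sum>l\<in>F. p ^ card (set l - {}) + (1 - p ^ k) * of_bool (set l \<subseteq> I))"
    unfolding sum.distrib sum_mult_of_bool[OF finite_F] APs_in_Collect[OF assms] by (simp add: G_def)
  also have "\<dots> \<le> G I"
    unfolding G_def
  proof (rule sum_mono)
    fix l assume l: "l \<in> F"
    show "p ^ card (set l - {}) + (1 - p ^ k) * of_bool (set l \<subseteq> I) \<le> p ^ card (set l - I)"
    proof (cases "set l \<subseteq> I")
      case True
      then show ?thesis using l by (simp add: APs_in_card_set Diff_eq_empty_iff[THEN iffD2])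
    next
      case False
      then show ?thesis using p_pos p_less_1 by (auto intro!: power_decreasing card_mono)
    qed
  qed
  finally show ?thesis .
qed

text \<open>Three ways to meet \<open>I\<close>: in all terms, so no factor \<open>p\<close>; in at
  least two but not all, so at least one factor \<open>p\<close>; only in \<open>x\<close>, so
  exactly \<open>k - 1\<close> factors.\<close>

lemma weight_le:
  assumes "l \<in> F" "x \<in> set l" "x \<in> I"
  shows "p ^ card (set l - I)
    \<le> p ^ (k - 1) + of_bool (set l \<subseteq> I) + p * of_bool (\<exists>y\<in>I. y \<noteq> x \<and> y \<in> set l)"
proof -
  consider "set l \<subseteq> I" | "\<not> set l \<subseteq> I" "\<exists>y\<in>I. y \<noteq> x \<and> y \<in> set l"
    | "\<not> (\<exists>y\<in>I. y \<noteq> x \<and> y \<in> set l)" by blast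
  then show ?thesis
  proof cases
    case 1
    then have "p ^ card (set l - I) = 1" by (simp add: Diff_eq_empty_iff[THEN iffD2])
    then show ?thesis using 1 p_pos by simp
  next
    case 2
    then have "card (set l - I) \<ge> 1" by (simp add: Suc_le_eq card_gt_0_iff)
    then have "p ^ card (set l - I) \<le> p ^ 1" using p_pos p_less_1 by (intro power_decreasing) auto
    then show ?thesis using 2 p_pos by (simp add: add_increasing)
  next
    case 3
    then have "set l - I = set l - {x}" using assms(2,3) by blast
    then show ?thesis using assms(1,2) p_pos by (simp add: APs_in_card_set)
  qed
qed

text \<open>Sums \<open>weight_le\<close> over the progressions meeting \<open>I\<close>; those that
  miss \<open>I\<close> keep their unconditioned weight. The last two terms come from progressions
  with at least two elements, respectively one element, in \<open>I\<close> and are error terms in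
  the application.\<close>

lemma G_le:
  assumes "I \<subseteq> V"
  shows "G I \<le> G {} + real (card (APs_in k I)) + p * (real k * real (card I))\<^sup>2
           + p ^ (k - 1) * (real k * real N * real (card I))"
proof -
  have fI: "finite I" by (rule finite_subset_V[OF assms])
  let ?E1 = "\<lambda>l. \<exists>x\<in>I. x \<in> set l" and ?E2 = "\<lambda>l. \<exists>x\<in>I. \<exists>y\<in>I. y \<noteq> x \<and> x \<in> set l \<and> y \<in> set l"
  have "G I \<le> (\<Sum>l\<in>F. p ^ card (set l - {}) + 1 * of_bool (set l \<subseteq> I)
      + p * of_bool (?E2 l) + p ^ (k - 1) * of_bool (?E1 l))"
    unfolding G_def
  proof (rule sum_mono)
    fix l assume l: "l \<in> F"
    show "p ^ card (set l - I) \<le> p ^ card (set l - {}) + 1 * of_bool (set l \<subseteq> I)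
      + p * of_bool (?E2 l) + p ^ (k - 1) * of_bool (?E1 l)"
    proof (cases "?E1 l")
      case True
      then obtain x where x: "x \<in> I" "x \<in> set l" by blast
      have "p * of_bool (\<exists>y\<in>I. y \<noteq> x \<and> y \<in> set l) \<le> p * of_bool (?E2 l)"
        using x p_pos by (auto simp: of_bool_def)
      moreover have "0 \<le> p ^ card (set l - {})" using p_pos by simp
      ultimately show ?thesis using weight_le[OF l x(2,1)] True by (simp del: of_bool_eq_iff)
    next
      case False
      then have "set l - I = set l" by blast
      then show ?thesis using p_pos by simp
    qed
  qed
  also have "\<dots> = G {} + real (card (APs_in k I)) + p * real (card {l \<in> F. ?E2 l})
      + p ^ (k - 1) * real (card {l \<in> F. ?E1 l})"
    unfolding sum.distrib sum_mult_of_bool[OF finite_F] APs_in_Collect[OF assms] by (simp add: G_def)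
  also have "\<dots> \<le> G {} + real (card (APs_in k I)) + p * (real k * real (card I))\<^sup>2
           + p ^ (k - 1) * (real k * real N * real (card I))"
  proof -
    let ?Q = "{q \<in> I \<times> I. fst q \<noteq> snd q}"
    have "{l \<in> F. ?E2 l} = (\<Union>q\<in>?Q. {l \<in> F. fst q \<in> set l \<and> snd q \<in> set l})" by force
    then have "card {l \<in> F. ?E2 l} \<le> (\<Sum>q\<in>?Q. card {l \<in> F. fst q \<in> set l \<and> snd q \<in> set l})"
      using fI by (simp only:) (intro card_UN_le, auto)
    also have "\<dots> \<le> (\<Sum>q\<in>?Q. k ^ 2)" by (intro sum_mono card_APs_through_two) auto
    also have "\<dots> = card ?Q * k ^ 2" by simp
    also have "\<dots> \<le> card (I \<times> I) * k ^ 2" using fI by (intro mult_right_mono card_mono) auto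
    finally have "real (card {l \<in> F. ?E2 l}) \<le> real (card (I \<times> I) * k ^ 2)" by (rule of_nat_mono)
    then have E2: "real (card {l \<in> F. ?E2 l}) \<le> (real k * real (card I))\<^sup>2"
      by (simp add: card_cartesian_product power2_eq_square mult_ac)
    have "{l \<in> F. ?E1 l} = (\<Union>x\<in>I. {l \<in> F. x \<in> set l})" by blast
    then have "card {l \<in> F. ?E1 l} \<le> (\<Sum>x\<in>I. card {l \<in> F. x \<in> set l})"
      using fI by (simp only:) (intro card_UN_le)
    also have "\<dots> \<le> (\<Sum>x\<in>I. k * card V)"
      using k_ge_3 by (intro sum_mono card_APs_through) auto
    finally have "card {l \<in> F. ?E1 l} \<le> k * N * card I" by (simp add: mult_ac)
    then have "real (card {l \<in> F. ?E1 l}) \<le> real (k * N * card I)" by (rule of_nat_mono)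
    then have E1: "real (card {l \<in> F. ?E1 l}) \<le> real k * real N * real (card I)" by simp
    show ?thesis using E1 E2 p_pos by (intro add_mono mult_left_mono) auto
  qed
  finally show ?thesis .
qed

text \<open>Only progressions through \<open>x\<close> are affected by removing \<open>x\<close>. In
  a core the left side is at least \<theta>, so this is what forces many progressions through
  \<open>x\<close> inside the core.\<close>

lemma G_marginal:
  assumes "I \<subseteq> V" "x \<in> I"
  shows "G I - G (I - {x}) \<le> real (card {l \<in> APs_in k I. x \<in> set l})
           + p * ((real k)\<^sup>2 * real (card I)) + p ^ (k - 1) * (real k * real N)"
proof -
  have fI: "finite I" by (rule finite_subset_V[OF assms(1)])
  let ?Fx = "{l \<in> F. x \<in> set l}"
  have fF: "finite ?Fx" using finite_F by simp
  have "G I - G (I - {x}) = (\<Sum>l\<in>F. p ^ card (set l - I) - p ^ card (set l - (I - {x})))"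
    by (simp add: G_def sum_subtractf)
  also have "\<dots> = (\<Sum>l\<in>?Fx. p ^ card (set l - I) - p ^ card (set l - (I - {x})))"
  proof (rule sum.mono_neutral_right)
    show "\<forall>l\<in>F - ?Fx. p ^ card (set l - I) - p ^ card (set l - (I - {x})) = 0"
    proof
      fix l assume "l \<in> F - ?Fx"
      then have "set l - (I - {x}) = set l - I" by blast
      then show "p ^ card (set l - I) - p ^ card (set l - (I - {x})) = 0" by simp
    qed
  qed (use finite_F in auto)
  also have "\<dots> \<le> (\<Sum>l\<in>?Fx. p ^ (k - 1) + 1 * of_bool (set l \<subseteq> I) + p * of_bool (\<exists>y\<in>I. y \<noteq> x \<and> y \<in> set l))"
  proof (rule sum_mono)
    fix l assume l: "l \<in> ?Fx"
    have "0 \<le> p ^ card (set l - (I - {x}))" using p_pos by simp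
    then show "p ^ card (set l - I) - p ^ card (set l - (I - {x}))
        \<le> p ^ (k - 1) + 1 * of_bool (set l \<subseteq> I) + p * of_bool (\<exists>y\<in>I. y \<noteq> x \<and> y \<in> set l)"
      using weight_le[of l x I] l assms(2) unfolding mult_1 by simp
  qed
  also have "\<dots> = p ^ (k - 1) * real (card ?Fx) + real (card {l \<in> ?Fx. set l \<subseteq> I})
      + p * real (card {l \<in> ?Fx. \<exists>y\<in>I. y \<noteq> x \<and> y \<in> set l})"
    unfolding sum.distrib sum_mult_of_bool[OF fF] by (simp add: mult.commute)
  also have "\<dots> \<le> p ^ (k - 1) * (real k * real N) + real (card {l \<in> APs_in k I. x \<in> set l})
      + p * ((real k)\<^sup>2 * real (card I))"
  proof -
    have 1: "card ?Fx \<le> k * N" using card_APs_through[of k V x] k_ge_3 by simp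
    have "{l \<in> ?Fx. set l \<subseteq> I} = {l \<in> APs_in k I. x \<in> set l}" using assms(1) by (auto simp: APs_in_iff)
    then have 2: "card {l \<in> ?Fx. set l \<subseteq> I} = card {l \<in> APs_in k I. x \<in> set l}" by simp
    have "{l \<in> ?Fx. \<exists>y\<in>I. y \<noteq> x \<and> y \<in> set l} = (\<Union>y\<in>I - {x}. {l \<in> F. x \<in> set l \<and> y \<in> set l})" by blast
    then have "card {l \<in> ?Fx. \<exists>y\<in>I. y \<noteq> x \<and> y \<in> set l}
        \<le> (\<Sum>y\<in>I - {x}. card {l \<in> F. x \<in> set l \<and> y \<in> set l})"
      using fI by (simp only:) (intro card_UN_le, auto)
    also have "\<dots> \<le> (\<Sum>y\<in>I - {x}. k ^ 2)" by (intro sum_mono card_APs_through_two) auto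
    also have "\<dots> = card (I - {x}) * k ^ 2" by simp
    also have "\<dots> \<le> card I * k ^ 2" using fI by (intro mult_right_mono card_mono) auto
    finally have 3: "card {l \<in> ?Fx. \<exists>y\<in>I. y \<noteq> x \<and> y \<in> set l} \<le> k ^ 2 * card I" by (simp add: mult.commute)
    have "real (card ?Fx) \<le> real k * real N" using of_nat_mono[OF 1, where 'a = real] by simp
    moreover have "real (card {l \<in> ?Fx. \<exists>y\<in>I. y \<noteq> x \<and> y \<in> set l}) \<le> (real k)\<^sup>2 * real (card I)"
      using of_nat_mono[OF 3, where 'a = real] by simp
    ultimately show ?thesis unfolding 2 using p_pos by (intro add_mono mult_left_mono) auto
  qed
  finally show ?thesis by simp
qed

text \<open>If no seed is present, \<open>upper_tail_no_seed\<close> gives the first term. Otherwise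
  \<open>R\<close> contains a core, whose size is at least \<mu> by \<open>large\<close> and whose
  elements have at least \<open>D\<close> neighbours by \<open>deg\<close>; a union bound over the
  cores of each size costs at most \<open>b\<close> per size.\<close>

lemma upper_tail_le:
  fixes n :: nat and t \<tau> \<theta> D \<eta> Q \<mu> b :: real
  assumes "t > 0" "\<tau> \<ge> 0" "\<theta> \<ge> 0" "\<mu> > 0"
    and large: "\<And>J. J \<subseteq> V \<Longrightarrow> card J \<le> k * n \<Longrightarrow> G J \<ge> \<tau> - \<theta> * real (k * n) \<Longrightarrow> \<mu> \<le> real (card J)"
    and deg: "(real k)\<^sup>2 * D \<le> \<theta> - p * ((real k)\<^sup>2 * real (k * n)) - p ^ (k - 1) * (real k * real N)"
    and \<eta>: "0 < \<eta>" "10 * \<eta> \<le> 1" "\<eta> ^ 4 * D \<ge> real (k ^ 3)"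
    and Q: "Q \<ge> 1" "(real (k ^ 3))\<^sup>2 * real (k * n) \<le> Q * (\<eta> ^ 4 * D)"
    and b: "b \<ge> 0" "\<And>m. \<mu> \<le> real m \<Longrightarrow> m \<le> N \<Longrightarrow>
      (exp 1 * real N / (10 * \<eta> * m)) powr (10 * \<eta> * m) * (exp 1 * Q) powr m * p ^ m \<le> b"
  shows "measure_pmf.prob (random_subset N p) {R. X R \<ge> t} \<le> (\<tau> / t) ^ n + real (N + 1) * b"
proof -
  let ?P = "measure_pmf.prob (random_subset N p)"
  define \<I> where "\<I> m = {I. I \<subseteq> V \<and> card I = m \<and>
    (\<forall>x\<in>I. real (card {z \<in> I. \<exists>y\<in>I. AP_triple k x y z}) \<ge> D)}" for m
  define ms where "ms = {m. \<mu> \<le> real m \<and> m \<le> N \<and> m \<le> k * n}"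
  have fms: "finite ms" by (rule finite_subset[of _ "{..N}"]) (auto simp: ms_def)
  have f\<I>: "finite (\<I> m)" for m by (rule finite_subset[of _ "Pow V"]) (auto simp: \<I>_def)
  define Z where "Z = {R. X R \<ge> t \<and> (\<forall>J\<subseteq>R. J \<subseteq> V \<longrightarrow> card J \<le> k * n \<longrightarrow> G J < \<tau>)}"
  have "{R. X R \<ge> t} \<subseteq> Z \<union> (\<Union>m\<in>ms. \<Union>I\<in>\<I> m. {R. I \<subseteq> R})"
  proof
    fix R assume R: "R \<in> {R. X R \<ge> t}"
    show "R \<in> Z \<union> (\<Union>m\<in>ms. \<Union>I\<in>\<I> m. {R. I \<subseteq> R})"
    proof (cases "R \<in> Z")
      case False
      then obtain I where I: "I \<subseteq> R" "I \<subseteq> V" "card I \<le> k * n" "G I \<ge> \<tau>"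
        using R by (auto simp: Z_def not_less)
      obtain J where J: "J \<subseteq> I" "G J \<ge> \<tau> - \<theta> * (real (card I) - real (card J))"
        "\<And>x. x \<in> J \<Longrightarrow> G J - G (J - {x}) \<ge> \<theta>"
        using exists_core[OF I(2,4), of \<theta>] by auto
      have JV: "J \<subseteq> V" using J(1) I(2) by (rule order_trans)
      have cJ: "card J \<le> card I" using J(1) finite_subset_V[OF I(2)] by (rule card_mono[rotated])
      \<comment> \<open>The pruning loss is at most \<theta> per element of the seed, and the seed
        has at most \<open>k * n\<close> elements.\<close>
      have "\<theta> * (real (card I) - real (card J)) \<le> \<theta> * real (k * n)"
        using assms(3) I(3) by (intro mult_left_mono) linarith+
      then have "\<mu> \<le> real (card J)"
        using J(2) cJ I(3) by (intro large JV) linarith+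
      moreover have "card J \<le> N" using card_mono[OF _ JV] by simp
      ultimately have "card J \<in> ms" using cJ I(3) by (simp add: ms_def)
      moreover have "J \<in> \<I> (card J)"
        unfolding \<I>_def
      proof (safe)
        show "x \<in> V" if "x \<in> J" for x using that JV by blast
        fix x assume x: "x \<in> J"
        have "real (card J) \<le> real (k * n)" using cJ I(3) by linarith
        then have "p * ((real k)\<^sup>2 * real (card J)) \<le> p * ((real k)\<^sup>2 * real (k * n))"
          using p_pos by (intro mult_left_mono) auto
        then have "(real k)\<^sup>2 * D \<le> real (card {l \<in> APs_in k J. x \<in> set l})"
          using deg J(3)[OF x] G_marginal[OF JV x] by linarith
        also have "\<dots> \<le> real (k ^ 2 * card {z \<in> J. \<exists>y\<in>J. AP_triple k x y z})"
          using finite_subset_V[OF JV] k_ge_3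
          by (intro of_nat_mono card_APs_through_le_neighbours)
        finally have "(real k)\<^sup>2 * D \<le> (real k)\<^sup>2 * real (card {z \<in> J. \<exists>y\<in>J. AP_triple k x y z})"
          by simp
        then show "D \<le> real (card {z \<in> J. \<exists>y\<in>J. AP_triple k x y z})"
          using k_ge_3 by (subst (asm) mult_le_cancel_left_pos) auto
      qed
      ultimately show ?thesis using J(1) I(1) by blast
    qed blast
  qed
  then have "?P {R. X R \<ge> t} \<le> ?P (Z \<union> (\<Union>m\<in>ms. \<Union>I\<in>\<I> m. {R. I \<subseteq> R}))"
    by (intro measure_pmf.finite_measure_mono) auto
  also have "\<dots> \<le> ?P Z + ?P (\<Union>m\<in>ms. \<Union>I\<in>\<I> m. {R. I \<subseteq> R})"
    by (intro measure_Un_le) auto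
  also have "?P (\<Union>m\<in>ms. \<Union>I\<in>\<I> m. {R. I \<subseteq> R}) \<le> (\<Sum>m\<in>ms. ?P (\<Union>I\<in>\<I> m. {R. I \<subseteq> R}))"
    using fms by (intro measure_UNION_le) auto
  also have "\<dots> \<le> (\<Sum>m\<in>ms. b)"
  proof (rule sum_mono)
    fix m assume m: "m \<in> ms"
    then have m_pos: "m > 0" using assms(4) by (auto simp: ms_def intro: Nat.gr0I)
    have "?P (\<Union>I\<in>\<I> m. {R. I \<subseteq> R}) \<le> (\<Sum>I\<in>\<I> m. ?P {R. I \<subseteq> R})"
      using f\<I> by (intro measure_UNION_le) auto
    also have "\<dots> = (\<Sum>I\<in>\<I> m. p ^ m)"
      by (intro sum.cong refl) (auto simp: \<I>_def prob_supset)
    also have "\<dots> = real (card (\<I> m)) * p ^ m" by simp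
    also have "\<dots> \<le> (exp 1 * real (card V) / (10 * \<eta> * m)) powr (10 * \<eta> * m) * (exp 1 * Q) powr m * p ^ m"
    proof (intro mult_right_mono)
      have "real m \<le> real (k * n)" using m by (simp add: ms_def del: of_nat_mult)
      then have "(real (k ^ 3))\<^sup>2 * m \<le> (real (k ^ 3))\<^sup>2 * real (k * n)" by (intro mult_left_mono) auto
      then show "real (card (\<I> m)) \<le> (exp 1 * real (card V) / (10 * \<eta> * m)) powr (10 * \<eta> * m) * (exp 1 * Q) powr m"
        unfolding \<I>_def using m_pos \<eta> Q by (intro card_dense_sets) linarith+
    qed (use p_pos in simp)
    also have "\<dots> \<le> b" using b(2)[of m] m by (simp add: ms_def)
    finally show "?P (\<Union>I\<in>\<I> m. {R. I \<subseteq> R}) \<le> b" .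
  qed
  also have "\<dots> \<le> real (N + 1) * b"
  proof -
    have "card ms \<le> card {..N}" by (rule card_mono) (auto simp: ms_def)
    then have "real (card ms) * b \<le> real (N + 1) * b" using b(1) by (intro mult_right_mono) auto
    then show ?thesis by simp
  qed
  also have "?P Z \<le> (\<tau> / t) ^ n"
    unfolding Z_def using assms(1,2) by (intro upper_tail_no_seed) (auto simp: APs_in_card_set)
  finally show ?thesis by simp
qed

text \<open>Plants the interval \<open>{1..m}\<close>, with \<open>B\<close> standing for
  \<open>N p^(k/2)\<close>. The bound on \<gamma> makes \<open>B^2 * \<gamma>\<close> a lower bound
  for the excess of \<open>G\<close> at the interval over
  \<open>(1 + \<delta>) * G {}\<close>.\<close>

lemma upper_tail_ge_interval:
  fixes c \<gamma> \<delta> B :: real and m :: nat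
  assumes "N \<ge> 1" "m \<le> N" "0 < c" "c * B \<le> m" "B > 0" "c * B \<ge> real k - 1"
    and B2: "p ^ k * (real N)\<^sup>2 = B\<^sup>2" and "\<delta> \<ge> 0"
    and \<gamma>: "\<gamma> \<le> (1 - p ^ k) * (c\<^sup>2 / (2 * (real k - 1)) - c / (2 * B))
      - \<delta> / (2 * (real k - 1)) - \<delta> / (2 * real N)"
  shows "p ^ (m + k) * \<gamma> \<le> measure_pmf.prob (random_subset N p) {R. X R \<ge> (1 + \<delta>) * G {}}"
proof (cases "\<gamma> \<le> 0")
  case True
  then have "p ^ (m + k) * \<gamma> \<le> 0" using p_pos by (simp add: mult_nonneg_nonpos)
  then show ?thesis by (rule order_trans) simp
next
  case False
  define q where "q = real k - 1"
  have q: "q \<ge> 2" using k_ge_3 by (simp add: q_def)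
  let ?I = "{1..int m}"
  have I: "?I \<subseteq> V" using assms(2) by auto
  define P where "P = measure_pmf.prob (random_subset N p) {R. X R \<ge> (1 + \<delta>) * G {}}"
  have "B\<^sup>2 * (c\<^sup>2 / (2 * q) - c / (2 * B)) = (c * B) * (c * B / q - 1) / 2"
    using assms(5) q by (simp add: field_simps power2_eq_square)
  \<comment> \<open>The product grows with \<open>c * B\<close> because both factors are nonnegative
    when \<open>c * B \<ge> k - 1\<close>.\<close>
  also have "\<dots> \<le> real m * (real m / q - 1) / 2"
    using assms(3-6) q
    by (intro divide_right_mono mult_mono diff_right_mono) (auto simp: q_def field_simps)
  also have "\<dots> = (real m)\<^sup>2 / (2 * q) - real m / 2"
    by (simp add: power2_eq_square right_diff_distrib diff_divide_distrib)
  also have "\<dots> \<le> real (card (APs_in k ?I))"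
    unfolding q_def using k_ge_3 by (intro card_APs_in_interval_ge) auto
  finally have A: "B\<^sup>2 * (c\<^sup>2 / (2 * q) - c / (2 * B)) \<le> real (card (APs_in k ?I))" .
  have cF: "real (card F) \<le> (real N)\<^sup>2 / (2 * q) + real N / 2"
    using card_APs_in_le[of k V] k_ge_3 by (simp add: q_def)
  have "G {} \<le> p ^ k * ((real N)\<^sup>2 / (2 * q) + real N / 2)"
    unfolding G_empty using mult_right_mono[OF cF, of "p ^ k"] p_pos by (simp add: mult.commute)
  also have "\<dots> = (p ^ k * (real N)\<^sup>2) * (1 / (2 * q) + 1 / (2 * real N))"
    using assms(1) by (simp add: distrib_left power2_eq_square)
  finally have G0: "G {} \<le> B\<^sup>2 * (1 / (2 * q) + 1 / (2 * real N))" unfolding B2 .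
  have p_le: "p ^ k \<le> 1" using p_pos p_less_1 by (simp add: power_le_one)
  have "B\<^sup>2 * \<gamma> \<le> B\<^sup>2 * ((1 - p ^ k) * (c\<^sup>2 / (2 * q) - c / (2 * B)) - \<delta> / (2 * q) - \<delta> / (2 * real N))"
    using \<gamma> by (intro mult_left_mono) (auto simp: q_def)
  also have "\<dots> = (1 - p ^ k) * (B\<^sup>2 * (c\<^sup>2 / (2 * q) - c / (2 * B))) - \<delta> * (B\<^sup>2 * (1 / (2 * q) + 1 / (2 * real N)))"
    by (simp add: algebra_simps)
  also have "\<dots> \<le> (1 - p ^ k) * real (card (APs_in k ?I)) - \<delta> * G {}"
    using A G0 p_le assms(8) by (intro diff_mono mult_left_mono) auto
  also have "\<dots> \<le> G ?I - (1 + \<delta>) * G {}"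
    using G_ge[OF I] by (simp add: algebra_simps)
  finally have "p ^ m * (B\<^sup>2 * \<gamma>) \<le> p ^ m * (G ?I - (1 + \<delta>) * G {})"
    using p_pos by (intro mult_left_mono) auto
  also have "\<dots> \<le> real (card F) * P"
    unfolding P_def using upper_tail_ge[OF I, of "(1 + \<delta>) * G {}"] assms(8) p_pos by (simp add: G_empty)
  also have "\<dots> \<le> (real N)\<^sup>2 * P"
  proof (rule mult_right_mono)
    have "(real N)\<^sup>2 / (2 * q) \<le> (real N)\<^sup>2 / 2" using q by (intro divide_left_mono) auto
    moreover have "real N \<le> (real N)\<^sup>2" using assms(1) by (simp add: power2_eq_square)
    ultimately show "real (card F) \<le> (real N)\<^sup>2" using cF by linarith
  qed (simp add: P_def)
  \<comment> \<open>The loss \<open>card F \<le> N^2\<close> in reverse Markov is offset by the gain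
    \<open>B^2 = p^k N^2\<close>, leaving only the factor \<open>p ^ k\<close>.\<close>
  finally have "(real N)\<^sup>2 * (p ^ (m + k) * \<gamma>) \<le> (real N)\<^sup>2 * P"
    unfolding B2[symmetric] by (simp add: power_add mult_ac)
  then show ?thesis using assms(1) by (simp add: P_def)
qed

text \<open>Takes \<tau> = (1 + \<delta> - \<epsilon>) E, where E is the mean, and spends the slack
  4 \<epsilon>: one \<epsilon> in the Markov step, one in pruning to a core, one in replacing E by
  \<open>B^2 / (2 q)\<close>, one in the error terms of \<open>G_le\<close>. Thus a core has at
  least \<open>sqrt (\<delta> - 4 * \<epsilon>) * B\<close> elements.\<close>

lemma upper_tail_le_explicit:
  fixes n :: nat and B L v C \<epsilon> \<delta> \<eta> b :: real
  defines "q \<equiv> real k - 1"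
  defines "c1 \<equiv> \<epsilon> / (4 * q * C)"
  defines "Q \<equiv> 2 * real k ^ 8 * C / (\<eta> ^ 4 * c1) * L\<^sup>2"
  assumes "N \<ge> 1" "B > 0" "L > 0" "C > 0" "0 < \<epsilon>" "4 * \<epsilon> < \<delta>" "n > 0"
    and B2: "p ^ k * (real N)\<^sup>2 = B\<^sup>2" and Bv: "p ^ (k - 1) * real N = B * v"
    and n: "real (k * n) \<le> C * B * L"
    and h1: "q / real N \<le> 1 / 2" "(\<delta> - 2 * \<epsilon>) * (1 - q / real N) \<ge> \<delta> - 3 * \<epsilon>"
    and h2: "C / 2 * (L / B) + (real k)\<^sup>2 * C\<^sup>2 * (p * L\<^sup>2) + real k * C * (v * L) \<le> \<epsilon> / (2 * q)"
    and h3: "(real k)\<^sup>2 * C * (p * L\<^sup>2) + real k * (v * L) \<le> c1 / 2"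
    and \<eta>: "0 < \<eta>" "10 * \<eta> \<le> 1" "\<eta> ^ 4 * (c1 / (2 * (real k)\<^sup>2)) * (B / L) \<ge> real (k ^ 3)"
    and Q: "Q \<ge> 1"
    and b: "b \<ge> 0" "\<And>m::nat. sqrt (\<delta> - 4 * \<epsilon>) * B \<le> real m \<Longrightarrow>
      (exp 1 * real N / (10 * \<eta> * m)) powr (10 * \<eta> * m) * (exp 1 * Q) powr m * p ^ m \<le> b"
  shows "measure_pmf.prob (random_subset N p) {R. X R \<ge> (1 + \<delta>) * G {}}
    \<le> ((1 + \<delta> - \<epsilon>) / (1 + \<delta>)) ^ n + real (N + 1) * b"
proof -
  have q: "q \<ge> 2" using k_ge_3 by (simp add: q_def)
  define M where "M = real (k * n)"
  have M: "M > 0" "M \<le> C * B * L" using k_ge_3 assms(10) n by (auto simp: M_def)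
  have c1: "c1 > 0" using q assms(7,8) by (simp add: c1_def)
  have v: "v \<ge> 0"
  proof -
    have "0 \<le> B * v" unfolding Bv[symmetric] using p_pos by simp
    then show ?thesis using assms(5) by (simp add: zero_le_mult_iff)
  qed
  have G0: "G {} \<ge> B\<^sup>2 / (2 * q) * (1 - q / real N)"
  proof -
    have "B\<^sup>2 / (2 * q) * (1 - q / real N) = p ^ k * ((real N)\<^sup>2 / (2 * q) - real N / 2)"
      unfolding B2[symmetric] using assms(4) q by (simp add: field_simps power2_eq_square)
    also have "\<dots> \<le> p ^ k * real (card F)"
      unfolding q_def using k_ge_3 p_pos by (intro mult_left_mono card_APs_in_interval_ge) auto
    finally show ?thesis by (simp add: G_empty mult.commute)
  qed
  have "B\<^sup>2 / (2 * q) * (1 / 2) \<le> B\<^sup>2 / (2 * q) * (1 - q / real N)"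
    using h1(1) q by (intro mult_left_mono) auto
  then have G0': "G {} \<ge> B\<^sup>2 / (4 * q)" using G0 by simp
  moreover have "B\<^sup>2 / (4 * q) > 0" using assms(5) q by simp
  ultimately have G0_pos: "G {} > 0" by linarith
  \<comment> \<open>The pruning loss over a whole seed is at most \<theta> M = \<epsilon>
    \<open>G {}\<close>. Below, \<open>D\<close> is half of the lower bound
    \<open>c1 * (B / L)\<close> for \<theta>, divided by \<open>k^2\<close>; the other half absorbs
    the error terms of \<open>G_marginal\<close>.\<close>
  define \<theta> where "\<theta> = \<epsilon> * G {} / M"
  define D where "D = c1 / (2 * (real k)\<^sup>2) * (B / L)"
  have \<theta>M: "\<theta> * M = \<epsilon> * G {}" using M by (simp add: \<theta>_def)
  have "c1 * (B / L) = \<epsilon> * (B\<^sup>2 / (4 * q)) / (C * B * L)"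
    using assms(5-7) q by (simp add: c1_def field_simps power2_eq_square)
  also have "\<dots> \<le> \<epsilon> * G {} / M"
    using M G0' G0_pos assms(5-8) by (intro frac_le mult_left_mono) auto
  finally have \<theta>: "c1 * (B / L) \<le> \<theta>" by (simp add: \<theta>_def)
  have Gle: "(\<delta> - 2 * \<epsilon>) * G {} \<ge> (\<delta> - 3 * \<epsilon>) * (B\<^sup>2 / (2 * q))"
  proof -
    have "(\<delta> - 3 * \<epsilon>) * (B\<^sup>2 / (2 * q)) \<le> (\<delta> - 2 * \<epsilon>) * (1 - q / real N) * (B\<^sup>2 / (2 * q))"
      using h1(2) q by (intro mult_right_mono) auto
    also have "\<dots> = (\<delta> - 2 * \<epsilon>) * (B\<^sup>2 / (2 * q) * (1 - q / real N))" by simp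
    also have "\<dots> \<le> (\<delta> - 2 * \<epsilon>) * G {}" using G0 assms(8,9) by (intro mult_left_mono) auto
    finally show ?thesis .
  qed
  have large: "sqrt (\<delta> - 4 * \<epsilon>) * B \<le> real (card J)"
    if J: "J \<subseteq> V" "card J \<le> k * n" "G J \<ge> (1 + \<delta> - \<epsilon>) * G {} - \<theta> * real (k * n)" for J
  proof -
    define j where "j = real (card J)"
    have jM: "0 \<le> j" "j \<le> C * B * L" using J(2) M(2) unfolding j_def M_def by linarith+
    have "(\<delta> - 2 * \<epsilon>) * G {} \<le> G J - G {}"
      using J(3) \<theta>M unfolding M_def by (simp add: algebra_simps)
    also have "\<dots> \<le> real (card (APs_in k J)) + p * (real k * j)\<^sup>2 + p ^ (k - 1) * (real k * real N * j)"
      using G_le[OF J(1)] by (simp add: j_def)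
    also have "\<dots> \<le> (j\<^sup>2 / (2 * q) + j / 2) + p * (real k * j)\<^sup>2 + (p ^ (k - 1) * real N) * (real k * j)"
      using card_APs_in_le[of k J] finite_subset_V[OF J(1)] k_ge_3 by (simp add: q_def j_def mult_ac)
    also have "\<dots> \<le> (j\<^sup>2 / (2 * q) + C * B * L / 2) + p * (real k * (C * B * L))\<^sup>2 + (B * v) * (real k * (C * B * L))"
      unfolding Bv using jM p_pos assms(5) v q by (intro add_mono mult_left_mono power_mono divide_right_mono) auto
    also have "\<dots> = j\<^sup>2 / (2 * q) + B\<^sup>2 * (C / 2 * (L / B) + (real k)\<^sup>2 * C\<^sup>2 * (p * L\<^sup>2) + real k * C * (v * L))"
      using assms(5) by (simp add: distrib_left power2_eq_square mult_ac)
    also have "\<dots> \<le> j\<^sup>2 / (2 * q) + B\<^sup>2 * (\<epsilon> / (2 * q))"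
      using h2 by (intro add_left_mono mult_left_mono) auto
    finally have "(\<delta> - 3 * \<epsilon>) * (B\<^sup>2 / (2 * q)) \<le> j\<^sup>2 / (2 * q) + B\<^sup>2 * (\<epsilon> / (2 * q))"
      using Gle by linarith
    then have "(\<delta> - 4 * \<epsilon>) * B\<^sup>2 / (2 * q) \<le> j\<^sup>2 / (2 * q)"
      by (simp add: algebra_simps diff_divide_distrib add_divide_distrib)
    then have "(\<delta> - 4 * \<epsilon>) * B\<^sup>2 \<le> j\<^sup>2" using q by (simp add: divide_le_cancel)
    then have "sqrt ((\<delta> - 4 * \<epsilon>) * B\<^sup>2) \<le> sqrt (j\<^sup>2)" by (rule real_sqrt_le_mono)
    then show ?thesis using jM(1) assms(5) by (simp add: real_sqrt_mult j_def)
  qed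
  have deg: "(real k)\<^sup>2 * D \<le> \<theta> - p * ((real k)\<^sup>2 * real (k * n)) - p ^ (k - 1) * (real k * real N)"
  proof -
    have "p * ((real k)\<^sup>2 * M) + p ^ (k - 1) * (real k * real N)
      \<le> p * ((real k)\<^sup>2 * (C * B * L)) + (p ^ (k - 1) * real N) * real k"
      using M(2) p_pos by (intro add_mono mult_left_mono) (auto simp: mult_ac)
    also have "\<dots> = (B / L) * ((real k)\<^sup>2 * C * (p * L\<^sup>2) + real k * (v * L))"
      unfolding Bv using assms(6) by (simp add: distrib_left power2_eq_square mult_ac)
    also have "\<dots> \<le> (B / L) * (c1 / 2)" using h3 assms(5,6) by (intro mult_left_mono) auto
    finally have "p * ((real k)\<^sup>2 * M) + p ^ (k - 1) * (real k * real N) \<le> c1 * (B / L) / 2" by (simp add: mult_ac)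
    moreover have "(real k)\<^sup>2 * D = c1 * (B / L) / 2" using k_ge_3 by (simp add: D_def)
    moreover have "y \<le> z - w - x" if "w + x \<le> t / 2" "y = t / 2" "t \<le> z" for t w x y z :: real
      using that by linarith
    ultimately show ?thesis using \<theta> unfolding M_def by blast
  qed
  have "(real (k ^ 3))\<^sup>2 * real (k * n) \<le> (real (k ^ 3))\<^sup>2 * (C * B * L)"
    using n by (intro mult_left_mono) auto
  \<comment> \<open>\<open>Q\<close> is defined so that the required bound on the number of
    candidates holds with equality at this point.\<close>
  also have "\<dots> = Q * (\<eta> ^ 4 * D)"
  proof -
    have "Q * (\<eta> ^ 4 * D) = (2 * real k ^ 8 * C * L\<^sup>2 / (2 * (real k)\<^sup>2) * (B / L)) * ((\<eta> ^ 4 * c1) / (\<eta> ^ 4 * c1))"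
      by (simp add: Q_def D_def)
    also have "(\<eta> ^ 4 * c1) / (\<eta> ^ 4 * c1) = 1" using c1 \<eta>(1) by simp
    also have "2 * real k ^ 8 * C * L\<^sup>2 / (2 * (real k)\<^sup>2) * (B / L) * 1 = (real (k ^ 3))\<^sup>2 * (C * B * L)"
    proof -
      have "real k ^ 8 / (real k)\<^sup>2 = real k ^ 6" using power_diff[of "real k" 2 8] k_ge_3 by simp
      moreover have "L\<^sup>2 / L = L" by (simp add: power2_eq_square)
      moreover have "2 * real k ^ 8 * C * L\<^sup>2 / (2 * (real k)\<^sup>2) * (B / L) * 1
          = (real k ^ 8 / (real k)\<^sup>2) * (C * B * (L\<^sup>2 / L))" by simp
      ultimately show ?thesis by simp
    qed
    finally show ?thesis by simp
  qed
  finally have Q2: "(real (k ^ 3))\<^sup>2 * real (k * n) \<le> Q * (\<eta> ^ 4 * D)" .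
  have "measure_pmf.prob (random_subset N p) {R. X R \<ge> (1 + \<delta>) * G {}}
    \<le> ((1 + \<delta> - \<epsilon>) * G {} / ((1 + \<delta>) * G {})) ^ n + real (N + 1) * b"
  proof (rule upper_tail_le[where D = D and \<eta> = \<eta> and Q = Q and \<mu> = "sqrt (\<delta> - 4 * \<epsilon>) * B" and \<theta> = \<theta>])
    show "0 < (1 + \<delta>) * G {}" "0 \<le> (1 + \<delta> - \<epsilon>) * G {}" using G0_pos assms(8,9) by simp_all
    show "0 \<le> \<theta>" using G0_pos assms(8) M by (simp add: \<theta>_def)
    show "0 < sqrt (\<delta> - 4 * \<epsilon>) * B" using assms(5,9) by simp
    show "real (k ^ 3) \<le> \<eta> ^ 4 * D" using \<eta>(3) by (simp add: D_def mult.assoc)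
  qed (use large deg \<eta> Q Q2 b in auto)
  then show ?thesis using G0_pos by simp
qed

end

section \<open>Asymptotics\<close>

locale sparse_regime =
  fixes k :: nat and p :: "nat \<Rightarrow> real"
  assumes k_ge_3: "k \<ge> 3"
    and p_bounds: "N \<ge> 1 \<Longrightarrow> 0 < p N \<and> p N < 1"
    and lim_dense: "(\<lambda>N. (ln (real N) / real N) / (p N powr (real k / 2))) \<longlonglongrightarrow> 0"
    and lim_sparse: "(\<lambda>N. p N powr (real k / 2)) \<longlonglongrightarrow> 0"
begin

section \<open>Parameters of the sparse regime and their limits\<close>

definition u :: "nat \<Rightarrow> real" where "u N = p N powr (real k / 2)"

definition B :: "nat \<Rightarrow> real" where "B N = real N * u N"

definition L :: "nat \<Rightarrow> real" where "L N = ln (1 / p N)"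

text \<open>Equals \<open>p\<close> to the power \<open>k / 2 - 1\<close>; it measures the
  contribution of progressions with a single term in the conditioned set, through
  \<open>p_power_k_minus_1\<close>.\<close>

definition v :: "nat \<Rightarrow> real" where "v N = u N / p N"

lemma u_pos: "N \<ge> 1 \<Longrightarrow> 0 < u N"
  using p_bounds[of N] by (simp add: u_def)

lemma B_pos: "N \<ge> 1 \<Longrightarrow> 0 < B N"
  using u_pos[of N] by (simp add: B_def)

lemma L_pos: "N \<ge> 1 \<Longrightarrow> 0 < L N"
  using p_bounds[of N] by (simp add: L_def)

lemma p_eq_exp: "N \<ge> 1 \<Longrightarrow> p N = exp (- L N)"
  using p_bounds[of N] by (simp add: L_def ln_div)

lemma p_power_k: "N \<ge> 1 \<Longrightarrow> p N ^ k = (u N)\<^sup>2"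
  using p_bounds[of N] by (simp add: u_def power2_eq_square flip: powr_add powr_realpow)

lemma p_power_k_minus_1:
  assumes "N \<ge> 1"
  shows "p N ^ (k - 1) * real N = B N * v N"
proof -
  have "p N ^ k = p N ^ (k - 1) * p N" using k_ge_3 by (metis One_nat_def Suc_pred power_Suc2 gr0I not_numeral_le_zero)
  then show ?thesis
    using p_power_k[OF assms] p_bounds[OF assms] by (simp add: B_def v_def field_simps power2_eq_square)
qed

lemma eventually_ge_1: "\<forall>\<^sub>F N in sequentially. N \<ge> (1 :: nat)"
  by (rule eventually_ge_at_top)

text \<open>Inverts \<open>u\<close>: \<open>p\<close> is its power \<open>2 / k\<close>. Approach
  from the right lets limits in the single variable \<open>p\<close> be composed with the
  sequence.\<close>

lemma p_at_right: "filterlim p (at_right 0) sequentially"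
proof -
  have "(\<lambda>N. u N powr (2 / real k)) \<longlonglongrightarrow> 0"
    by (rule tendsto_zero_powrI[of u _ _ "2 / real k"]) (use lim_sparse k_ge_3 in \<open>auto simp: u_def[abs_def]\<close>)
  moreover have "\<forall>\<^sub>F N in sequentially. u N powr (2 / real k) = p N"
    using eventually_ge_1
  proof eventually_elim
    case (elim N)
    then show ?case using p_bounds[of N] k_ge_3 by (simp add: u_def powr_powr)
  qed
  ultimately have "p \<longlonglongrightarrow> 0" using tendsto_cong by fastforce
  moreover have "\<forall>\<^sub>F N in sequentially. p N > 0"
    using eventually_ge_1 by eventually_elim (use p_bounds in auto)
  ultimately show ?thesis by (rule tendsto_imp_filterlim_at_right)
qed

lemma lim_L: "filterlim L at_top sequentially"
proof -
  have "filterlim (\<lambda>x::real. ln (1 / x)) at_top (at_right 0)" by real_asymp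
  from filterlim_compose[OF this p_at_right] show ?thesis by (simp add: L_def[abs_def])
qed

lemma lim_p_L: "(\<lambda>N. p N * (L N)\<^sup>2) \<longlonglongrightarrow> 0"
proof -
  have "((\<lambda>x::real. x * (ln (1 / x))\<^sup>2) \<longlongrightarrow> 0) (at_right 0)" by real_asymp
  from filterlim_compose[OF this p_at_right] show ?thesis by (simp add: L_def)
qed

lemma lim_v_L: "(\<lambda>N. v N * L N) \<longlonglongrightarrow> 0"
proof (rule tendsto_sandwich[where f = "\<lambda>_. 0" and h = "\<lambda>N. p N powr (1 / 2) * L N"])
  have "((\<lambda>x::real. x powr (1 / 2) * ln (1 / x)) \<longlongrightarrow> 0) (at_right 0)" by real_asymp
  from filterlim_compose[OF this p_at_right]
  show "(\<lambda>N. p N powr (1 / 2) * L N) \<longlonglongrightarrow> 0" by (simp add: L_def)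
  show "\<forall>\<^sub>F N in sequentially. 0 \<le> v N * L N"
    using eventually_ge_1
    by eventually_elim (use u_pos L_pos p_bounds in \<open>simp add: v_def less_imp_le\<close>)
  show "\<forall>\<^sub>F N in sequentially. v N * L N \<le> p N powr (1 / 2) * L N"
    using eventually_ge_1
  proof eventually_elim
    case (elim N)
    have "v N = p N powr (real k / 2 - 1)"
      using p_bounds[OF elim] by (simp add: v_def u_def powr_diff)
    \<comment> \<open>\<open>k / 2 - 1 \<ge> 1 / 2\<close> because \<open>k \<ge> 3\<close>, and the
      base is below 1.\<close>
    also have "\<dots> \<le> p N powr (1 / 2)"
      using p_bounds[OF elim] k_ge_3 by (intro powr_mono') auto
    finally show ?case using L_pos[OF elim] by simp
  qed
qed simp

lemma lim_ln_B: "(\<lambda>N. ln (real N) / B N) \<longlonglongrightarrow> 0"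
  using lim_dense by (simp add: B_def u_def)

lemma eventually_ln_le_B: "\<forall>\<^sub>F N in sequentially. ln (real N) \<le> B N"
  using order_tendstoD(2)[OF lim_ln_B zero_less_one] eventually_ge_1
  by eventually_elim (use B_pos in \<open>simp add: divide_less_eq\<close>)

lemma lim_B: "filterlim B at_top sequentially"
proof (rule filterlim_at_top_mono[OF _ eventually_ln_le_B])
  show "filterlim (\<lambda>N. ln (real N)) at_top sequentially" by real_asymp
qed

text \<open>Once \<open>B \<ge> 1\<close>, also \<open>1 / u \<le> N\<close>, so
  \<open>L \<le> (k / 2) * L = ln (1 / u) \<le> ln N\<close>; the lower bound on the density then
  applies in the form \<open>lim_ln_B\<close>.\<close>

lemma lim_L_div_B: "(\<lambda>N. L N / B N) \<longlonglongrightarrow> 0"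
proof (rule tendsto_sandwich[where f = "\<lambda>_. 0", OF _ _ _ lim_ln_B])
  show "\<forall>\<^sub>F N in sequentially. 0 \<le> L N / B N"
    using eventually_ge_1 by eventually_elim (use B_pos L_pos in \<open>simp add: less_imp_le\<close>)
  have "\<forall>\<^sub>F N in sequentially. B N \<ge> 1" using lim_B by (auto simp: filterlim_at_top)
  then show "\<forall>\<^sub>F N in sequentially. L N / B N \<le> ln (real N) / B N"
    using eventually_ge_1
  proof eventually_elim
    case (elim N)
    have "ln (1 / u N) \<le> ln (real N)"
      using elim u_pos[of N] by (intro ln_mono) (auto simp: B_def field_simps)
    moreover have "ln (1 / u N) = real k / 2 * L N"
      using p_bounds[of N] elim by (simp add: u_def L_def ln_div ln_powr)
    moreover have "1 * L N \<le> real k / 2 * L N"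
      using k_ge_3 L_pos[of N] elim by (intro mult_right_mono) auto
    ultimately show ?case using B_pos[of N] elim by (simp add: divide_right_mono)
  qed
qed simp

lemma lim_inverse_B: "(\<lambda>N. 1 / B N) \<longlonglongrightarrow> 0"
  using tendsto_inverse_0_at_top[OF lim_B] by (simp add: inverse_eq_divide)

lemma lim_inverse_L: "(\<lambda>N. 1 / L N) \<longlonglongrightarrow> 0"
  using tendsto_inverse_0_at_top[OF lim_L] by (simp add: inverse_eq_divide)

lemma random_APs_at: "N \<ge> 1 \<Longrightarrow> random_APs k (p N)"
  using k_ge_3 p_bounds[of N] by unfold_locales auto

section \<open>Bounds for the tail probability along the sequence\<close>

definition tail :: "real \<Rightarrow> nat \<Rightarrow> real" where
  "tail \<delta> N = measure_pmf.prob (random_subset N (p N))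
     {S. AP_count k S \<ge> (1 + \<delta>) * measure_pmf.expectation (random_subset N (p N)) (AP_count k)}"

lemma tail_eq:
  assumes "N \<ge> 1"
  shows "tail \<delta> N = measure_pmf.prob (random_subset N (p N))
    {R. random_hypergraph.X (APs_in k {1..int N}) set R
         \<ge> (1 + \<delta>) * random_hypergraph.G (p N) (APs_in k {1..int N}) set {}}"
proof -
  interpret random_APs k N "p N" by (rule random_APs_at[OF assms])
  show ?thesis unfolding tail_def expectation_AP_count by (rule prob_AP_count_ge)
qed

lemma p_power_k_N: "N \<ge> 1 \<Longrightarrow> p N ^ k * (real N)\<^sup>2 = (B N)\<^sup>2"
  by (simp add: p_power_k B_def power_mult_distrib mult.commute)

lemma lim_inverse_N: "(\<lambda>N. c / real N) \<longlonglongrightarrow> 0"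
  by (rule lim_const_over_n)

text \<open>An interval of length \<open>c * B\<close>, rounded up, has the excess required since
  \<open>c^2 > \<delta>\<close>. In the exponent, the 1 comes from the rounding and the
  \<open>k\<close> from reverse Markov.\<close>

lemma tail_lower_bound:
  assumes "\<delta> > 0" "c > sqrt \<delta>"
  shows "\<exists>\<gamma>>0. \<forall>\<^sub>F N in sequentially. \<gamma> * exp (- ((c * B N + 1 + real k) * L N)) \<le> tail \<delta> N"
proof -
  define q where "q = real k - 1"
  have q: "q \<ge> 2" using k_ge_3 by (simp add: q_def)
  have c: "c > 0" using assms by (meson less_trans real_sqrt_gt_zero)
  have "\<delta> < c\<^sup>2" using assms by (metis less_eq_real_def real_less_rsqrt real_sqrt_less_iff real_sqrt_unique not_less order_less_irrefl c real_sqrt_abs abs_of_pos)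
  \<comment> \<open>Half of the limit \<open>(c^2 - \<delta>) / (2 q)\<close> of the admissible
    surplus, so that it is eventually attained.\<close>
  define \<gamma> where "\<gamma> = (c\<^sup>2 - \<delta>) / (4 * q)"
  have \<gamma>: "\<gamma> > 0" using \<open>\<delta> < c\<^sup>2\<close> q by (simp add: \<gamma>_def)
  have "(\<lambda>N. (1 - (u N)\<^sup>2) * (c\<^sup>2 / (2 * q) - c / 2 * (1 / B N)) - \<delta> / (2 * q) - \<delta> / 2 / real N)
    \<longlonglongrightarrow> (1 - 0\<^sup>2) * (c\<^sup>2 / (2 * q) - c / 2 * 0) - \<delta> / (2 * q) - 0"
    using lim_sparse unfolding u_def[symmetric] by (intro tendsto_intros lim_inverse_B lim_inverse_N)
  moreover have "\<gamma> < (1 - 0\<^sup>2) * (c\<^sup>2 / (2 * q) - c / 2 * 0) - \<delta> / (2 * q) - 0"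
    using \<gamma> q by (simp add: \<gamma>_def field_simps)
  ultimately have ev1: "\<forall>\<^sub>F N in sequentially.
      \<gamma> < (1 - (u N)\<^sup>2) * (c\<^sup>2 / (2 * q) - c / 2 * (1 / B N)) - \<delta> / (2 * q) - \<delta> / 2 / real N"
    by (rule order_tendstoD(1))
  have ev2: "\<forall>\<^sub>F N in sequentially. B N \<ge> q / c"
    using lim_B by (auto simp: filterlim_at_top)
  \<comment> \<open>Guarantees that the rounded length \<open>m\<close> is at most
    \<open>N\<close>.\<close>
  have "(\<lambda>N. c * u N + 1 / real N) \<longlonglongrightarrow> c * 0 + 0"
    using lim_sparse unfolding u_def[symmetric] by (intro tendsto_intros lim_inverse_N)
  then have ev3: "\<forall>\<^sub>F N in sequentially. c * u N + 1 / real N < 1"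
    by (rule order_tendstoD(2)) simp
  have "\<forall>\<^sub>F N in sequentially. \<gamma> * exp (- ((c * B N + 1 + real k) * L N)) \<le> tail \<delta> N"
    using ev1 ev2 ev3 eventually_ge_1
  proof eventually_elim
    case (elim N)
    interpret random_APs k N "p N" using elim by (intro random_APs_at)
    define m where "m = nat \<lceil>c * B N\<rceil>"
    have m: "c * B N \<le> real m" "real m \<le> c * B N + 1"
      using c B_pos[of N] elim by (auto simp: m_def)
    have "c * B N + 1 = real N * (c * u N + 1 / real N)"
      using elim by (simp add: B_def field_simps)
    also have "\<dots> \<le> real N * 1" using elim by (intro mult_left_mono) auto
    finally have "m \<le> N" using m(2) by linarith
    have "p N ^ (m + k) * \<gamma> \<le> measure_pmf.prob (random_subset N (p N)) {R. X R \<ge> (1 + \<delta>) * G {}}"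
    proof (rule upper_tail_ge_interval)
      show "real k - 1 \<le> c * B N" using elim(2) c by (simp add: q_def field_simps)
      show "\<gamma> \<le> (1 - p N ^ k) * (c\<^sup>2 / (2 * (real k - 1)) - c / (2 * B N))
          - \<delta> / (2 * (real k - 1)) - \<delta> / (2 * real N)"
        using elim(1) p_power_k[of N] elim(4) by (simp add: q_def)
    qed (use elim c m \<open>m \<le> N\<close> assms(1) B_pos[of N] p_power_k_N[of N] in auto)
    moreover have "\<gamma> * exp (- ((c * B N + 1 + real k) * L N)) \<le> p N ^ (m + k) * \<gamma>"
    proof -
      have "real (m + k) * L N \<le> (c * B N + 1 + real k) * L N"
        using m(2) L_pos[of N] elim by (intro mult_right_mono) auto
      then have "exp (- ((c * B N + 1 + real k) * L N)) \<le> exp (real (m + k) * (- L N))" by simp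
      also have "\<dots> = p N ^ (m + k)" using p_eq_exp[of N] elim by (simp only: exp_of_nat_mult)
      finally show ?thesis using \<gamma> by (simp add: mult.commute)
    qed
    ultimately show ?case using tail_eq[of N \<delta>] elim by simp
  qed
  then show ?thesis using \<gamma> by blast
qed

text \<open>From \<open>m \<ge> c B\<close> follows \<open>N / m \<le> 1 / (c u)\<close>, and
  \<open>ln (1 / u) = (k / 2) L\<close>. Thus fingerprints cost
  \<open>5 * \<eta> * k * m * L\<close> in the exponent, while the remaining entropy is
  \<open>m\<close> times \<open>o(L)\<close>; together they stay below \<open>e * m * L\<close>, to
  be set against \<open>p ^ m = exp (- m L)\<close>.\<close>

lemma entropy_bound:
  assumes "c > 0" "\<eta> > 0" "c3 > 0" "5 * \<eta> * real k < e" "e < 1"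
  shows "\<forall>\<^sub>F N in sequentially. \<forall>m::nat. c * B N \<le> real m \<longrightarrow>
    (exp 1 * real N / (10 * \<eta> * m)) powr (10 * \<eta> * m) * (exp 1 * (c3 * (L N)\<^sup>2)) powr m * p N ^ m
      \<le> exp (- ((1 - e) * c * B N * L N))"
proof -
  define c4 where "c4 = exp 1 / (10 * \<eta> * c)"
  have c4: "c4 > 0" using assms by (simp add: c4_def)
  have "((\<lambda>x. (10 * \<eta> * ln c4 + 1 + ln (c3 * x\<^sup>2)) / x) \<longlongrightarrow> 0) at_top"
    using assms(3) by real_asymp
  from filterlim_compose[OF this lim_L]
  have "(\<lambda>N. 5 * \<eta> * real k + (10 * \<eta> * ln c4 + 1 + ln (c3 * (L N)\<^sup>2)) / L N) \<longlonglongrightarrow> 5 * \<eta> * real k + 0"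
    by (intro tendsto_intros)
  then have ev: "\<forall>\<^sub>F N in sequentially. 5 * \<eta> * real k + (10 * \<eta> * ln c4 + 1 + ln (c3 * (L N)\<^sup>2)) / L N < e"
    by (rule order_tendstoD(2)) (use assms in simp)
  show ?thesis
    using ev eventually_ge_1
  proof eventually_elim
    case (elim N)
    have L: "L N > 0" and u: "u N > 0" and B: "B N > 0" using L_pos u_pos B_pos elim by auto
    show ?case
    proof (intro allI impI)
      fix m :: nat assume m: "c * B N \<le> real m"
      have "c * B N > 0" using assms(1) B by simp
      then have m_pos: "real m > 0" using m by linarith
      have "(10 * \<eta> * ln c4 + 1 + ln (c3 * (L N)\<^sup>2)) / L N \<le> e - 5 * \<eta> * real k" using elim(1) by linarith
      then have key: "10 * \<eta> * ln c4 + 1 + ln (c3 * (L N)\<^sup>2) \<le> (e - 5 * \<eta> * real k) * L N"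
        using L by (simp add: pos_divide_le_eq)
      have "exp 1 * real N / (10 * \<eta> * m) \<le> exp 1 * real N / (10 * \<eta> * (c * B N))"
        using m assms(1,2) B m_pos by (intro divide_left_mono mult_left_mono) auto
      also have "\<dots> = c4 / u N" using elim by (simp add: c4_def B_def)
      finally have "(exp 1 * real N / (10 * \<eta> * m)) powr (10 * \<eta> * m) \<le> (c4 / u N) powr (10 * \<eta> * m)"
        using assms(2) by (intro powr_mono2) auto
      also have "\<dots> = exp (10 * \<eta> * m * ln (c4 / u N))"
        using c4 u by (simp add: powr_def)
      also have "ln (c4 / u N) = ln c4 + real k / 2 * L N"
        using c4 u p_bounds[of N] elim by (simp add: ln_div u_def L_def ln_powr)
      finally have 1: "(exp 1 * real N / (10 * \<eta> * m)) powr (10 * \<eta> * m)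
          \<le> exp (10 * \<eta> * m * (ln c4 + real k / 2 * L N))" .
      have 2: "(exp 1 * (c3 * (L N)\<^sup>2)) powr m = exp (real m * (1 + ln (c3 * (L N)\<^sup>2)))"
        using assms(3) L by (simp add: powr_def ln_mult)
      have 3: "p N ^ m = exp (real m * (- L N))" using p_eq_exp[of N] elim by (simp only: exp_of_nat_mult)
      have "(exp 1 * real N / (10 * \<eta> * m)) powr (10 * \<eta> * m) * (exp 1 * (c3 * (L N)\<^sup>2)) powr m * p N ^ m
        \<le> exp (10 * \<eta> * m * (ln c4 + real k / 2 * L N)) * exp (real m * (1 + ln (c3 * (L N)\<^sup>2))) * exp (real m * (- L N))"
        unfolding 2 3 by (intro mult_right_mono 1) auto
      also have "\<dots> = exp (real m * ((10 * \<eta> * ln c4 + 1 + ln (c3 * (L N)\<^sup>2)) + 5 * \<eta> * real k * L N - L N))"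
        unfolding exp_add[symmetric] by (simp add: algebra_simps)
      also have "\<dots> \<le> exp (real m * (- ((1 - e) * L N)))"
        using key m_pos unfolding exp_le_cancel_iff
        by (intro mult_left_mono) (simp_all add: algebra_simps)
      also have "\<dots> \<le> exp (- ((1 - e) * c * B N * L N))"
      proof -
        have "c * B N * ((1 - e) * L N) \<le> real m * ((1 - e) * L N)"
          using m assms(5) L by (intro mult_right_mono) auto
        then show ?thesis by (simp add: mult_ac)
      qed
      finally show "(exp 1 * real N / (10 * \<eta> * m)) powr (10 * \<eta> * m) * (exp 1 * (c3 * (L N)\<^sup>2)) powr m * p N ^ m
        \<le> exp (- ((1 - e) * c * B N * L N))" .
    qed
  qed
qed

text \<open>Both terms of \<open>upper_tail_le_explicit\<close> are brought below the same
  exponential: the cores by \<open>entropy_bound\<close>, the Markov term by taking \<open>n\<close>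
  large enough. The factor \<open>N + 2\<close> consists of \<open>N + 1\<close> for the sizes of
  cores and 1 for the Markov term.\<close>

lemma tail_upper_bound:
  assumes "\<delta> > 0" "0 < c" "c < sqrt \<delta>" "0 < e" "e < 1"
  shows "\<forall>\<^sub>F N in sequentially. tail \<delta> N \<le> (real N + 2) * exp (- ((1 - e) * c * B N * L N))"
proof -
  define q where "q = real k - 1"
  have q: "q \<ge> 2" using k_ge_3 by (simp add: q_def)
  have c2: "c\<^sup>2 < \<delta>" using assms(1-3) by (metis less_eq_real_def power_strict_mono real_sqrt_pow2 zero_less_numeral)
  \<comment> \<open>Makes the minimal core size \<open>sqrt (\<delta> - 4 * \<epsilon>) * B\<close>
    equal to \<open>c * B\<close>.\<close>
  define \<epsilon> where "\<epsilon> = (\<delta> - c\<^sup>2) / 4"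
  have "\<delta> - 4 * \<epsilon> = c\<^sup>2" by (simp add: \<epsilon>_def field_simps)
  then have \<epsilon>: "0 < \<epsilon>" "4 * \<epsilon> < \<delta>" "sqrt (\<delta> - 4 * \<epsilon>) = c"
    using c2 assms(2) by (auto simp: \<epsilon>_def)
  define \<rho> where "\<rho> = (1 + \<delta> - \<epsilon>) / (1 + \<delta>)"
  have \<rho>: "0 < \<rho>" "\<rho> < 1" using \<epsilon> assms(1) by (auto simp: \<rho>_def)
  \<comment> \<open>With \<open>n \<ge> K B L\<close> the Markov term is at most
    \<open>exp (- sqrt \<delta> B L)\<close>.\<close>
  define K where "K = sqrt \<delta> / ln (1 / \<rho>)"
  have K: "K > 0" "K * ln (1 / \<rho>) = sqrt \<delta>" using \<rho> assms(1) by (auto simp: K_def)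
  \<comment> \<open>The factor 2 allows for rounding \<open>n\<close> up, which at most doubles
    \<open>K B L\<close> once that is at least 1.\<close>
  define C where "C = 2 * real k * K"
  have C: "C > 0" using K k_ge_3 by (simp add: C_def)
  define c1 where "c1 = \<epsilon> / (4 * q * C)"
  have c1: "c1 > 0" using \<epsilon> q C by (simp add: c1_def)
  \<comment> \<open>Gives \<open>5 * \<eta> * k = e / 2\<close>, below the tolerance
    \<open>e\<close> of \<open>entropy_bound\<close>.\<close>
  define \<eta> where "\<eta> = e / (10 * real k)"
  have \<eta>: "0 < \<eta>" "10 * \<eta> \<le> 1" "5 * \<eta> * real k < e"
    using assms(4,5) k_ge_3 by (auto simp: \<eta>_def field_simps)
  define c3 where "c3 = 2 * real k ^ 8 * C / (\<eta> ^ 4 * c1)"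
  have c3: "c3 > 0" using C \<eta> c1 k_ge_3 by (simp add: c3_def)
  have BL_top: "filterlim (\<lambda>N. B N * L N) at_top sequentially"
    by (rule filterlim_at_top_mult_at_top[OF lim_B lim_L])
  have ev1: "\<forall>\<^sub>F N in sequentially. B N * L N \<ge> 1 / K" using BL_top by (auto simp: filterlim_at_top)
  have ev2: "\<forall>\<^sub>F N in sequentially. q / real N < 1 / 2"
    using lim_inverse_N[of q] by (rule order_tendstoD(2)) simp
  have "(\<lambda>N. (\<delta> - 2 * \<epsilon>) * (1 - q / real N)) \<longlonglongrightarrow> (\<delta> - 2 * \<epsilon>) * (1 - 0)"
    by (intro tendsto_intros lim_inverse_N)
  then have ev3: "\<forall>\<^sub>F N in sequentially. \<delta> - 3 * \<epsilon> < (\<delta> - 2 * \<epsilon>) * (1 - q / real N)"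
    by (rule order_tendstoD(1)) (use \<epsilon> in simp)
  have "(\<lambda>N. C / 2 * (L N / B N) + (real k)\<^sup>2 * C\<^sup>2 * (p N * (L N)\<^sup>2) + real k * C * (v N * L N))
      \<longlonglongrightarrow> C / 2 * 0 + (real k)\<^sup>2 * C\<^sup>2 * 0 + real k * C * 0"
    by (intro tendsto_intros lim_L_div_B lim_p_L lim_v_L)
  then have ev4: "\<forall>\<^sub>F N in sequentially. C / 2 * (L N / B N) + (real k)\<^sup>2 * C\<^sup>2 * (p N * (L N)\<^sup>2)
      + real k * C * (v N * L N) < \<epsilon> / (2 * q)"
    by (rule order_tendstoD(2)) (use \<epsilon> q in simp)
  have "(\<lambda>N. (real k)\<^sup>2 * C * (p N * (L N)\<^sup>2) + real k * (v N * L N)) \<longlonglongrightarrow> (real k)\<^sup>2 * C * 0 + real k * 0"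
    by (intro tendsto_intros lim_p_L lim_v_L)
  then have ev5: "\<forall>\<^sub>F N in sequentially. (real k)\<^sup>2 * C * (p N * (L N)\<^sup>2) + real k * (v N * L N) < c1 / 2"
    by (rule order_tendstoD(2)) (use c1 in simp)
  define w where "w = \<eta> ^ 4 * (c1 / (2 * (real k)\<^sup>2))"
  have w: "w > 0" using \<eta> c1 k_ge_3 by (simp add: w_def)
  have "(\<lambda>N. real (k ^ 3) * (L N / B N)) \<longlonglongrightarrow> real (k ^ 3) * 0" by (intro tendsto_intros lim_L_div_B)
  then have ev6: "\<forall>\<^sub>F N in sequentially. real (k ^ 3) * (L N / B N) < w"
    by (rule order_tendstoD(2)) (use w in simp)
  have "filterlim (\<lambda>x. c3 * x\<^sup>2) at_top at_top" using c3 by real_asymp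
  from filterlim_compose[OF this lim_L]
  have ev7: "\<forall>\<^sub>F N in sequentially. c3 * (L N)\<^sup>2 \<ge> 1" by (auto simp: filterlim_at_top)
  show ?thesis
    using ev1 ev2 ev3 ev4 ev5 ev6 ev7 entropy_bound[OF assms(2) \<eta>(1) c3 \<eta>(3) assms(5)] eventually_ge_1
  proof eventually_elim
    case (elim N)
    interpret random_APs k N "p N" using elim by (intro random_APs_at)
    have L: "L N > 0" and B: "B N > 0" using L_pos B_pos elim by auto
    define n where "n = nat \<lceil>K * (B N * L N)\<rceil>"
    have "K * (B N * L N) \<ge> 1" using elim(1) K(1) by (simp add: field_simps)
    then have n: "K * (B N * L N) \<le> real n" "real n \<le> 2 * (K * (B N * L N))" "n > 0"
      by (auto simp: n_def) linarith+
    have kn: "real (k * n) \<le> C * B N * L N"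
      using mult_left_mono[OF n(2), of "real k"] by (simp add: C_def mult_ac)
    define b where "b = exp (- ((1 - e) * c * B N * L N))"
    have "tail \<delta> N \<le> \<rho> ^ n + real (N + 1) * b"
      unfolding tail_eq[OF elim(9)] \<rho>_def
    proof (rule upper_tail_le_explicit[where C = C and \<eta> = \<eta> and v = "v N" and B = "B N" and L = "L N"],
        unfold q_def[symmetric], unfold c1_def[symmetric], unfold c3_def[symmetric])
      show "p N ^ (k - 1) * real N = B N * v N" by (rule p_power_k_minus_1[OF elim(9)])
      show "real (k ^ 3) \<le> \<eta> ^ 4 * (c1 / (2 * (real k)\<^sup>2)) * (B N / L N)"
        using elim(6) L B unfolding w_def[symmetric] by (simp add: field_simps)
      show "(exp 1 * real N / (10 * \<eta> * real m)) powr (10 * \<eta> * real m) * (exp 1 * (c3 * (L N)\<^sup>2)) powr real m * p N ^ m \<le> b"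
        if "sqrt (\<delta> - 4 * \<epsilon>) * B N \<le> real m" for m
        using elim(8) that unfolding b_def \<epsilon>(3) by blast
      show "p N ^ k * (real N)\<^sup>2 = (B N)\<^sup>2" by (rule p_power_k_N[OF elim(9)])
    qed (use elim L B C \<epsilon> n kn \<eta> in \<open>auto simp: b_def\<close>)
    also have "\<rho> ^ n \<le> b"
    proof -
      have "(1 - e) * c \<le> 1 * sqrt \<delta>" using assms by (intro mult_mono) auto
      then have "(1 - e) * c * (B N * L N) \<le> sqrt \<delta> * (B N * L N)" using L B by (intro mult_right_mono) auto
      also have "\<dots> = (K * (B N * L N)) * ln (1 / \<rho>)" using K(2) by (simp add: mult_ac)
      also have "\<dots> \<le> real n * ln (1 / \<rho>)" using n(1) \<rho> by (intro mult_right_mono) auto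
      also have "\<dots> = - (real n * ln \<rho>)" using \<rho> by (simp add: ln_div)
      finally have "real n * ln \<rho> \<le> - ((1 - e) * c * B N * L N)" by (simp add: mult_ac)
      moreover have "\<rho> ^ n = exp (real n * ln \<rho>)" using \<rho>(1) by (simp only: exp_of_nat_mult exp_ln)
      ultimately show ?thesis by (simp add: b_def)
    qed
    finally show ?case by (simp add: b_def algebra_simps)
  qed
qed

section \<open>Passing to the logarithmic rate\<close>

lemma tail_pos: 
  assumes "\<delta> > 0"
  shows "\<forall>\<^sub>F N in sequentially. tail \<delta> N > 0"
proof -
  obtain \<gamma> where \<gamma>: "\<gamma> > 0"
    "\<forall>\<^sub>F N in sequentially. \<gamma> * exp (- (((sqrt \<delta> + 1) * B N + 1 + real k) * L N)) \<le> tail \<delta> N"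
    using tail_lower_bound[OF assms, of "sqrt \<delta> + 1"] by auto
  from \<gamma>(2) show ?thesis
    by eventually_elim (use \<gamma>(1) in \<open>meson exp_gt_zero less_le_trans mult_pos_pos\<close>)
qed

text \<open>Any \<open>c\<close> strictly between \<open>sqrt \<delta>\<close> and \<open>a\<close>
  serves: after division by \<open>B L\<close>, the constant \<gamma> and the additive
  \<open>1 + k\<close> vanish in the limit.\<close>

lemma rate_less:
  assumes "\<delta> > 0" "a > sqrt \<delta>"
  shows "\<forall>\<^sub>F N in sequentially. - ln (tail \<delta> N) / (B N * L N) < a"
proof -
  define c where "c = (sqrt \<delta> + a) / 2"
  have c: "sqrt \<delta> < c" "c < a" using assms by (auto simp: c_def)
  obtain \<gamma> where \<gamma>: "\<gamma> > 0"
    "\<forall>\<^sub>F N in sequentially. \<gamma> * exp (- ((c * B N + 1 + real k) * L N)) \<le> tail \<delta> N"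
    using tail_lower_bound[OF assms(1) c(1)] by auto
  have "(\<lambda>N. c + (1 + real k) * (1 / B N) - ln \<gamma> * (1 / B N) * (1 / L N)) \<longlonglongrightarrow> c + (1 + real k) * 0 - ln \<gamma> * 0 * 0"
    by (intro tendsto_intros lim_inverse_B lim_inverse_L)
  then have "\<forall>\<^sub>F N in sequentially. c + (1 + real k) * (1 / B N) - ln \<gamma> * (1 / B N) * (1 / L N) < a"
    by (rule order_tendstoD(2)) (use c in simp)
  then show ?thesis
    using \<gamma>(2) eventually_ge_1
  proof eventually_elim
    case (elim N)
    have L: "L N > 0" and B: "B N > 0" using L_pos B_pos elim by auto
    have pos: "\<gamma> * exp (- ((c * B N + 1 + real k) * L N)) > 0" using \<gamma>(1) by simp
    have "ln \<gamma> - (c * B N + 1 + real k) * L N = ln (\<gamma> * exp (- ((c * B N + 1 + real k) * L N)))"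
      using \<gamma>(1) by (simp add: ln_mult)
    also have "\<dots> \<le> ln (tail \<delta> N)" using elim(2) pos by (intro ln_mono) auto
    finally have "- ln (tail \<delta> N) \<le> (c * B N + 1 + real k) * L N - ln \<gamma>" by simp
    then have "- ln (tail \<delta> N) / (B N * L N) \<le> ((c * B N + 1 + real k) * L N - ln \<gamma>) / (B N * L N)"
      using L B by (intro divide_right_mono) auto
    also have "\<dots> = c + (1 + real k) * (1 / B N) - ln \<gamma> * (1 / B N) * (1 / L N)"
      using L B by (simp add: field_simps)
    finally show ?case using elim(1) by simp
  qed
qed

text \<open>The prefactor \<open>N + 2\<close> contributes at most \<open>2 ln N\<close>, which is
  negligible against \<open>B L\<close> by \<open>lim_ln_B\<close>; hence any \<open>a\<close> below
  \<open>sqrt \<delta>\<close> is exceeded.\<close>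

lemma rate_greater:
  assumes "\<delta> > 0" "a < sqrt \<delta>"
  shows "\<forall>\<^sub>F N in sequentially. a < - ln (tail \<delta> N) / (B N * L N)"
proof -
  \<comment> \<open>\<open>max a 0\<close> keeps \<open>c\<close> positive even for negative
    \<open>a\<close>.\<close>
  define c where "c = (sqrt \<delta> + max a 0) / 2"
  have c: "0 < c" "c < sqrt \<delta>" "max a 0 < c"
    using assms real_sqrt_gt_zero[OF assms(1)] unfolding c_def max_def by (auto split: if_splits)
  \<comment> \<open>Leaves \<open>(1 - e) * c\<close> strictly above \<open>max a 0\<close>.\<close>
  define e where "e = (1 - max a 0 / c) / 2"
  have "max a 0 / c < 1" "0 \<le> max a 0 / c" using c by auto
  then have e: "0 < e" "e < 1" "max a 0 / c < 1 - e" by (auto simp: e_def field_simps)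
  have "a \<le> max a 0" by simp
  also have "\<dots> < (1 - e) * c" using e(3) c(1) by (simp add: pos_divide_less_eq)
  finally have ac: "a < (1 - e) * c" .
  have "(\<lambda>N. (1 - e) * c - 2 * (ln (real N) / B N) * (1 / L N)) \<longlonglongrightarrow> (1 - e) * c - 2 * 0 * 0"
    by (intro tendsto_intros lim_ln_B lim_inverse_L)
  then have "\<forall>\<^sub>F N in sequentially. a < (1 - e) * c - 2 * (ln (real N) / B N) * (1 / L N)"
    by (rule order_tendstoD(1)) (use ac in simp)
  then show ?thesis
    using tail_upper_bound[OF assms(1) c(1,2) e(1,2)] tail_pos[OF assms(1)] eventually_ge_at_top[of 2]
  proof eventually_elim
    case (elim N)
    have L: "L N > 0" and B: "B N > 0" using L_pos B_pos elim by auto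
    have "real N + 2 \<le> real N * real N"
      using elim(4) mult_right_mono[of 2 "real N" "real N"] by linarith
    then have "ln (real N + 2) \<le> ln (real N * real N)" using elim(4) by (intro ln_mono) auto
    also have "\<dots> = 2 * ln (real N)" using elim(4) by (simp add: ln_mult)
    finally have lnN: "ln (real N + 2) \<le> 2 * ln (real N)" .
    have "ln (tail \<delta> N) \<le> ln ((real N + 2) * exp (- ((1 - e) * c * B N * L N)))"
      using elim(2,3) by (intro ln_mono) auto
    also have "\<dots> = ln (real N + 2) - (1 - e) * c * B N * L N"
      by (simp add: ln_mult)
    finally have "(1 - e) * c * B N * L N - 2 * ln (real N) \<le> - ln (tail \<delta> N)" using lnN by linarith
    then have "((1 - e) * c * B N * L N - 2 * ln (real N)) / (B N * L N) \<le> - ln (tail \<delta> N) / (B N * L N)"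
      using L B by (intro divide_right_mono) auto
    moreover have "((1 - e) * c * B N * L N - 2 * ln (real N)) / (B N * L N)
        = (1 - e) * c - 2 * (ln (real N) / B N) * (1 / L N)"
      using L B by (simp add: diff_divide_distrib)
    ultimately show ?case using elim(1) by linarith
  qed
qed

end

theorem theorem1p3:
  fixes k :: nat and \<delta> :: real and p :: "nat \<Rightarrow> real"
  assumes "k \<ge> 3"
    and "\<delta> > 0"
    and "\<And>N. N \<ge> 1 \<Longrightarrow> 0 < p N \<and> p N < 1"
    and "(\<lambda>N. (ln (real N) / real N) / (p N powr (real k / 2))) \<longlonglongrightarrow> 0"
    and "(\<lambda>N. p N powr (real k / 2)) \<longlonglongrightarrow> 0"
  shows "(\<lambda>N. - ln (measure_pmf.prob (random_subset N (p N))
                  {S. AP_count k S \<ge>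
                      (1 + \<delta>) * measure_pmf.expectation (random_subset N (p N)) (AP_count k)})
              / (real N * p N powr (real k / 2) * ln (1 / p N)))
         \<longlonglongrightarrow> sqrt \<delta>"
proof -
  interpret sparse_regime k p using assms by unfold_locales auto
  have "(\<lambda>N. - ln (tail \<delta> N) / (B N * L N)) \<longlonglongrightarrow> sqrt \<delta>"
    by (rule order_tendstoI) (use rate_greater rate_less assms(2) in auto)
  then show ?thesis by (simp only: tail_def B_def u_def L_def)
qed

end
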